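(* For two density operators $\rho$ and $\sigma$, we have $$D(\rho|\sigma)\ \ge\ S(\sigma)-S(\rho)+\mathrm{Tr}\left[\exp(-\rho\log\rho)\exp(\sigma\log\sigma)-I\right]\ \ge\ 0.$$
   Context: A density operator is a self-adjoint positive operator (on a Hilbert space) with unit trace. For a density operator $\rho$, $S(\rho):=-\mathrm{Tr}[\rho\log\rho]$ is the quantum (von Neumann) entropy. For two density operators $\rho$ and $\sigma$, $D(\rho|\sigma):=\mathrm{Tr}[\rho(\log\rho-\log\sigma)]$ is the quantum relative entropy. $\mathrm{Tr}$ denotes the trace, $I$ is the identity operator, and functions of operators such as $\log\rho$ and $\exp(-\rho\log\rho)$ are taken in the sense of functional calculus.
   Formalization: Both density operators are assumed to have finite entropy (automatic in finite dimension), since otherwise the middle expression is of the form ∞ − ∞; D(ρ|σ) is read as the limit of Tr[ρ log ρ − ρ log(σ+ε)] as ε decreases to 0, possibly +∞. *)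

theory Defs
  imports "HOL-Analysis.Analysis"
begin

section \<open>Complex Hilbert spaces\<close>

text \<open>
  The norm, the topology and the completeness are those of the underlying real Hilbert space
  (\<open>real_inner\<close> and \<open>banach\<close>); the complex structure is linked to it by
  \<open>scaleR_scaleC\<close> and \<open>Re_cinner\<close>. The complex inner product is conjugate-linear in its first
  argument. No restriction on the dimension is made.
\<close>

class chilbert_space = real_inner + banach +
  fixes scaleC :: "complex \<Rightarrow> 'a \<Rightarrow> 'a"  (infixr "*\<^sub>C" 75)
    and cinner :: "'a \<Rightarrow> 'a \<Rightarrow> complex"
  assumes scaleC_add_right: "c *\<^sub>C (x + y) = c *\<^sub>C x + c *\<^sub>C y"
    and scaleC_add_left: "(c + d) *\<^sub>C x = c *\<^sub>C x + d *\<^sub>C x"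
    and scaleC_scaleC: "c *\<^sub>C d *\<^sub>C x = (c * d) *\<^sub>C x"
    and scaleR_scaleC: "r *\<^sub>R x = complex_of_real r *\<^sub>C x"
    and cinner_commute: "cinner x y = cnj (cinner y x)"
    and cinner_add_right: "cinner x (y + z) = cinner x y + cinner x z"
    and cinner_scaleC_right: "cinner x (c *\<^sub>C y) = c * cinner x y"
    and Re_cinner: "Re (cinner x y) = inner x y"

instantiation complex :: chilbert_space
begin

definition scaleC_complex :: "complex \<Rightarrow> complex \<Rightarrow> complex" where
  "scaleC_complex c z = c * z"

definition cinner_complex :: "complex \<Rightarrow> complex \<Rightarrow> complex" where
  "cinner_complex z w = cnj z * w"

instance
  by standard
    (auto simp: scaleC_complex_def cinner_complex_def algebra_simps scaleR_conv_of_real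
      inner_complex_def)

end

instantiation vec :: (chilbert_space, finite) chilbert_space
begin

definition scaleC_vec :: "complex \<Rightarrow> 'a ^ 'b \<Rightarrow> 'a ^ 'b" where
  "scaleC_vec c x = (\<chi> i. c *\<^sub>C (x $ i))"

definition cinner_vec :: "'a ^ 'b \<Rightarrow> 'a ^ 'b \<Rightarrow> complex" where
  "cinner_vec x y = (\<Sum>i\<in>UNIV. cinner (x $ i) (y $ i))"

instance
proof
  fix x y :: "'a ^ 'b"
  show "cinner x y = cnj (cinner y x)"
    unfolding cinner_vec_def cnj_sum by (intro sum.cong refl cinner_commute)
qed (simp_all add: scaleC_vec_def cinner_vec_def vec_eq_iff scaleC_add_right scaleC_add_left
    scaleC_scaleC scaleR_scaleC cinner_add_right cinner_scaleC_right Re_cinner inner_vec_def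
    sum.distrib sum_distrib_left)

end


section \<open>Trace and density operators\<close>

definition bounded_clinear :: "('a::chilbert_space \<Rightarrow> 'a) \<Rightarrow> bool" where
  "bounded_clinear A \<longleftrightarrow> bounded_linear A \<and> (\<forall>c x. A (c *\<^sub>C x) = c *\<^sub>C A x)"

definition is_onb :: "'a::chilbert_space set \<Rightarrow> bool" where
  "is_onb B \<longleftrightarrow>
     (\<forall>x\<in>B. \<forall>y\<in>B. cinner x y = (if x = y then 1 else 0)) \<and>
     (\<forall>x. (\<forall>b\<in>B. cinner b x = 0) \<longrightarrow> x = 0)"

text \<open>
  A bounded operator is of trace class iff its diagonal is summable (unconditionally) in every
  orthonormal basis, and then all these sums agree.
\<close>

definition has_trace :: "('a::chilbert_space \<Rightarrow> 'a) \<Rightarrow> complex \<Rightarrow> bool" where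
  "has_trace A t \<longleftrightarrow> (\<forall>B. is_onb B \<longrightarrow> ((\<lambda>e. cinner e (A e)) has_sum t) B)"

definition trace_class :: "('a::chilbert_space \<Rightarrow> 'a) \<Rightarrow> bool" where
  "trace_class A \<longleftrightarrow> bounded_clinear A \<and> (\<exists>t. has_trace A t)"

definition op_trace :: "('a::chilbert_space \<Rightarrow> 'a) \<Rightarrow> complex" where
  "op_trace A = (THE t. has_trace A t)"

definition density_operator :: "('a::chilbert_space \<Rightarrow> 'a) \<Rightarrow> bool" where
  "density_operator \<rho> \<longleftrightarrow>
     bounded_clinear \<rho> \<and>
     (\<forall>x y. cinner x (\<rho> y) = cinner (\<rho> x) y) \<and>
     (\<forall>x. 0 \<le> Re (cinner x (\<rho> x))) \<and>
     has_trace \<rho> 1"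


section \<open>Functional calculus\<close>

definition eigenspace :: "('a::chilbert_space \<Rightarrow> 'a) \<Rightarrow> real \<Rightarrow> 'a set" where
  "eigenspace A l = {x. A x = l *\<^sub>R x}"

definition orth_proj :: "'a::chilbert_space set \<Rightarrow> 'a \<Rightarrow> 'a" where
  "orth_proj V x = (THE y. y \<in> V \<and> (\<forall>z\<in>V. cinner z (x - y) = 0))"

text \<open>
  \<open>fun_calc f A\<close> is \<open>f(A) = \<Sum> f(l) P\<^sub>l\<close>, summed over the eigenvalues \<open>l\<close> of \<open>A\<close> with spectral
  projections \<open>P\<^sub>l\<close> (convergence in norm at each vector). This is the functional calculus for
  self-adjoint operators with an orthonormal basis of eigenvectors. Density operators are of this
  kind, being compact, and it is only used for them, with \<open>f\<close> bounded on the spectrum. Since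
  \<open>ln 0 = 0\<close> in HOL, \<open>t * ln t\<close> obeys the usual convention \<open>0 log 0 = 0\<close>.
\<close>

definition fun_calc :: "(real \<Rightarrow> real) \<Rightarrow> ('a::chilbert_space \<Rightarrow> 'a) \<Rightarrow> 'a \<Rightarrow> 'a" where
  "fun_calc f A x =
     (\<Sum>\<^sub>\<infinity>l\<in>{l. eigenspace A l \<noteq> {0}}. f l *\<^sub>R orth_proj (eigenspace A l) x)"


section \<open>Entropies\<close>

text \<open>
  \<open>S(\<rho>)\<close>, for \<open>\<rho>\<close> of finite entropy, that is, with \<open>\<rho> log \<rho>\<close> of trace class (automatic in finite
  dimension). The trace is real; \<open>Re\<close> is only a coercion, here and below.
\<close>

definition vn_entropy :: "('a::chilbert_space \<Rightarrow> 'a) \<Rightarrow> real" where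
  "vn_entropy \<rho> = - Re (op_trace (fun_calc (\<lambda>t. t * ln t) \<rho>))"

text \<open>
  \<open>Tr[\<rho> (log \<rho> - log \<sigma>)]\<close> with values in the extended reals, for \<open>\<rho>\<close> of finite entropy. As \<open>log \<sigma>\<close>
  is unbounded in infinite dimension and undefined on the kernel of \<open>\<sigma>\<close>, the expectation of
  \<open>- log \<sigma>\<close> in the state \<open>\<rho>\<close> is taken, as usual, as the monotone limit of the expectations of the
  bounded operators \<open>- log (\<sigma> + \<epsilon>)\<close> for \<open>\<epsilon>\<close> decreasing to \<open>0\<close>. For finite-dimensional invertible \<open>\<sigma>\<close>
  this is the plain trace; if the kernel of \<open>\<sigma>\<close> is not contained in that of \<open>\<rho>\<close>, the value
  is \<open>\<infinity>\<close>.
\<close>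

definition rel_entropy :: "('a::chilbert_space \<Rightarrow> 'a) \<Rightarrow> ('a \<Rightarrow> 'a) \<Rightarrow> ereal" where
  "rel_entropy \<rho> \<sigma> =
     (SUP \<epsilon>\<in>{0<..}. ereal (Re (op_trace
        (\<lambda>x. fun_calc (\<lambda>t. t * ln t) \<rho> x - \<rho> (fun_calc (\<lambda>t. ln (t + \<epsilon>)) \<sigma> x)))))"

end

theory Submission
  imports Defs "HOL-Complex_Analysis.Great_Picard" "HOL-Real_Asymp.Real_Asymp"
begin

text \<open>
  A density operator is compact, hence has an orthonormal eigenbasis. Let \<open>r\<^sub>i\<close> and \<open>s\<^sub>j\<close> be the
  eigenvalues of \<open>\<rho>\<close> and \<open>\<sigma>\<close>, with eigenvectors \<open>e\<^sub>i\<close> and \<open>f\<^sub>j\<close>. The weights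
  \<open>w\<^sub>i\<^sub>j = |\<langle>e\<^sub>i, f\<^sub>j\<rangle>|\<^sup>2\<close> are doubly stochastic, so every trace in question is a \<open>w\<close>-weighted
  double sum of a function of \<open>r\<^sub>i\<close> and \<open>s\<^sub>j\<close>, and both inequalities hold term by term.
  With \<open>f t = t log t\<close>, the second one is \<open>exp u - 1 \<ge> u\<close> at \<open>u = f s - f r\<close>. The first one, after adding
  the vanishing sum of \<open>s - r\<close>, is \<open>exp (f s - f r) - 1 \<le> (s - r) f' s\<close>, the tangent inequality at \<open>s\<close>
  for \<open>exp (- f)\<close>, which is concave on \<open>[0, 1]\<close> because \<open>s (1 + log s)\<^sup>2 \<le> 1\<close> there.
\<close>

section \<open>Orthonormal systems in complex Hilbert spaces\<close>

text \<open>Compactness has to be extracted from the trace: for a positive \<open>A\<close> with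
  bound \<open>K\<close>, the inequality A^2 <= K A makes the squared norms
  \<open>(norm (A b))\<^sup>2\<close> summable over a basis, so \<open>A\<close> is small off
  finitely many directions. \<open>has_trace\<close> asks for the same sum in every orthonormal
  basis, whereas \<rho> and \<sigma> are diagonal in different ones. All traces therefore go through
  absolutely convergent series of rank-one operators, where Fubini and Parseval make the basis
  disappear. In infinite dimension the product of the two exponentials has no trace; only its
  difference from the identity has one. It is reached through g h - 1 = (g - 1) h + (h - 1): finite
  entropy and |exp u - 1| <= 2 |u| make the diagonals g - 1 and h - 1 summable, and h is
  bounded.\<close>

lemma cinner_add_left: "cinner (x + y) z = cinner x z + cinner y (z :: 'a::chilbert_space)"
  by (metis cinner_add_right cinner_commute complex_cnj_add)

lemma cinner_scaleC_left: "cinner (c *\<^sub>C x) y = cnj c * cinner x (y :: 'a::chilbert_space)"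
  by (metis cinner_commute cinner_scaleC_right complex_cnj_mult)

lemma cinner_scaleR_right: "cinner x (r *\<^sub>R y) = complex_of_real r * cinner x (y :: 'a::chilbert_space)"
  by (simp add: scaleR_scaleC cinner_scaleC_right)

lemma cinner_scaleR_left: "cinner (r *\<^sub>R x) y = complex_of_real r * cinner x (y :: 'a::chilbert_space)"
  by (simp add: scaleR_scaleC cinner_scaleC_left)

lemma cinner_self: "cinner x x = complex_of_real ((norm x)\<^sup>2)" for x :: "'a::chilbert_space"
proof (rule complex_eqI)
  show "Re (cinner x x) = Re (complex_of_real ((norm x)\<^sup>2))"
    by (simp add: Re_cinner power2_norm_eq_inner)
  show "Im (cinner x x) = Im (complex_of_real ((norm x)\<^sup>2))"
    using arg_cong[OF cinner_commute[of x x], of Im] by simp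
qed

lemma norm_scaleC: "norm (c *\<^sub>C x) = cmod c * norm (x :: 'a::chilbert_space)"
proof -
  have "complex_of_real ((norm (c *\<^sub>C x))\<^sup>2) = complex_of_real ((cmod c * norm x)\<^sup>2)"
    unfolding cinner_self[symmetric] cinner_scaleC_left cinner_scaleC_right
    by (simp only: cinner_self power_mult_distrib of_real_mult complex_norm_square mult.assoc
        mult.left_commute)
  then have "(norm (c *\<^sub>C x))\<^sup>2 = (cmod c * norm x)\<^sup>2"
    by (simp only: of_real_eq_iff)
  then show ?thesis by simp
qed

text \<open>Real Cauchy-Schwarz, once \<open>y\<close> is multiplied by the unimodular
  \<open>c\<close> that turns \<open>cinner x y\<close> into its modulus.\<close>

lemma cmod_cinner_le: "cmod (cinner x y) \<le> norm x * norm (y :: 'a::chilbert_space)"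
proof (cases "cinner x y = 0")
  case False
  define c where "c = cnj (cinner x y) / cmod (cinner x y)"
  have "c * cinner x y = cmod (cinner x y)"
    using False complex_norm_square[of "cinner x y"]
    by (simp add: c_def divide_simps power2_eq_square mult_ac)
  then have "cmod (cinner x y) = Re (cinner x (c *\<^sub>C y))"
    by (simp add: cinner_scaleC_right)
  also have "\<dots> \<le> norm x * norm (c *\<^sub>C y)"
    unfolding Re_cinner by (rule norm_cauchy_schwarz)
  also have "\<dots> = norm x * norm y"
    using False by (simp add: norm_scaleC c_def norm_divide)
  finally show ?thesis .
qed simp

lemma bounded_linear_cinner_right: "bounded_linear (cinner (x :: 'a::chilbert_space))"
  by (rule bounded_linear_intro[where K = "norm x"])
    (auto simp: cinner_add_right cinner_scaleR_right scaleR_conv_of_real mult.commute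
      intro: order_trans[OF cmod_cinner_le])

lemma bounded_linear_cinner_left: "bounded_linear (\<lambda>y. cinner y (x :: 'a::chilbert_space))"
  by (rule bounded_linear_intro[where K = "norm x"])
    (auto simp: cinner_add_left cinner_scaleR_left scaleR_conv_of_real
      intro: order_trans[OF cmod_cinner_le])

lemma bounded_linear_scaleC: "bounded_linear (\<lambda>c. c *\<^sub>C (x :: 'a::chilbert_space))"
  by (rule bounded_linear_intro[where K = "norm x"])
    (simp_all only: scaleC_add_left norm_scaleC scaleR_scaleC[where 'a = 'a] scaleC_scaleC
      scaleR_conv_of_real order_refl)

lemmas cinner_zero_right [simp] = linear_0[OF bounded_linear.linear[OF bounded_linear_cinner_right]]
lemmas cinner_diff_right = linear_diff[OF bounded_linear.linear[OF bounded_linear_cinner_right]]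
lemmas cinner_sum_right = linear_sum[OF bounded_linear.linear[OF bounded_linear_cinner_right]]
lemmas cinner_sum_left = linear_sum[OF bounded_linear.linear[OF bounded_linear_cinner_left]]
lemmas scaleC_zero_left [simp] = linear_0[OF bounded_linear.linear[OF bounded_linear_scaleC]]

lemma cmod_cinner_commute: "cmod (cinner x y) = cmod (cinner y (x :: 'a::chilbert_space))"
  by (metis cinner_commute complex_mod_cnj)

lemma cinner_mult_commute: "cinner x y * cinner y x = complex_of_real ((cmod (cinner y (x :: 'a::chilbert_space)))\<^sup>2)"
  by (metis cinner_commute complex_norm_square mult.commute)

definition orthonormal :: "'a::chilbert_space set \<Rightarrow> bool" where
  "orthonormal S \<longleftrightarrow> (\<forall>x\<in>S. \<forall>y\<in>S. cinner x y = (if x = y then 1 else 0))"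

lemma orthonormalD: "orthonormal S \<Longrightarrow> x \<in> S \<Longrightarrow> y \<in> S \<Longrightarrow> cinner x y = (if x = y then 1 else 0)"
  by (simp add: orthonormal_def)

lemma orthonormal_norm: "orthonormal S \<Longrightarrow> x \<in> S \<Longrightarrow> norm x = 1"
  using orthonormalD[of S x x] cinner_self[of x] norm_ge_zero[of x]
  by (metis abs_norm_cancel of_real_eq_1_iff power2_eq_1_iff real_sqrt_abs real_sqrt_one)

lemma orthonormal_subset: "orthonormal S \<Longrightarrow> T \<subseteq> S \<Longrightarrow> orthonormal T"
  unfolding orthonormal_def by (intro ballI) (metis subsetD)

lemma is_onb_orthonormal: "is_onb B \<Longrightarrow> orthonormal B"
  by (simp add: is_onb_def orthonormal_def)

lemma cinner_orthonormal_sum: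
  assumes "orthonormal S" "finite F" "F \<subseteq> S" "t \<in> S"
  shows "cinner t (\<Sum>s\<in>F. c s *\<^sub>C s) = (if t \<in> F then c t else 0)"
proof -
  have "cinner t (\<Sum>s\<in>F. c s *\<^sub>C s) = (\<Sum>s\<in>F. if t = s then c s else 0)"
    unfolding cinner_sum_right
    by (intro sum.cong refl) (use assms in \<open>auto simp: cinner_scaleC_right orthonormalD\<close>)
  then show ?thesis using assms(2) by simp
qed

lemma norm_orthonormal_sum:
  assumes "orthonormal S" "finite F" "F \<subseteq> S"
  shows "(norm (\<Sum>s\<in>F. c s *\<^sub>C s))\<^sup>2 = (\<Sum>s\<in>F. (cmod (c s))\<^sup>2)"
proof -
  have "complex_of_real ((norm (\<Sum>s\<in>F. c s *\<^sub>C s))\<^sup>2)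
      = (\<Sum>t\<in>F. cnj (c t) * cinner t (\<Sum>s\<in>F. c s *\<^sub>C s))"
    unfolding cinner_self[symmetric] by (subst cinner_sum_left) (simp add: cinner_scaleC_left)
  also have "\<dots> = (\<Sum>t\<in>F. cnj (c t) * c t)"
    by (intro sum.cong refl, subst cinner_orthonormal_sum[OF assms]) (use assms in auto)
  also have "\<dots> = complex_of_real (\<Sum>s\<in>F. (cmod (c s))\<^sup>2)"
    by (simp only: of_real_sum complex_norm_square mult.commute)
  finally show ?thesis by (simp only: of_real_eq_iff)
qed

text \<open>By Pythagoras the squared norm of a block of the series is the same block of the squared
  moduli, so the net of finite sums is Cauchy and completeness supplies the limit.\<close>

lemma orthonormal_summable:
  fixes S :: "'a::chilbert_space set"
  assumes S: "orthonormal S" and c: "(\<lambda>s. (cmod (c s))\<^sup>2) summable_on S"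
  shows "(\<lambda>s. c s *\<^sub>C s) summable_on S"
proof -
  define g where "g s = (cmod (c s))\<^sup>2" for s
  let ?f = "\<lambda>s. c s *\<^sub>C s"
  from c obtain L where "(sum g \<longlongrightarrow> L) (finite_subsets_at_top S)"
    unfolding has_sum_def summable_on_def g_def by blast
  then have cauchy: "cauchy_filter (filtermap (sum g) (finite_subsets_at_top S))"
    by (auto intro!: nhds_imp_cauchy_filter simp: filterlim_def)
  have "\<exists>P. eventually P (finite_subsets_at_top S) \<and>
          (\<forall>F F'. P F \<and> P F' \<longrightarrow> dist (sum ?f F) (sum ?f F') < e)" if e: "e > 0" for e
  proof -
    have "\<exists>P. eventually P (finite_subsets_at_top S) \<and>
          (\<forall>F F'. P F \<and> P F' \<longrightarrow> dist (sum g F) (sum g F') < (e/2)\<^sup>2)"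
      using cauchy e unfolding cauchy_filter_metric_filtermap by simp
    then obtain P where P: "eventually P (finite_subsets_at_top S)"
      and d: "\<And>F F'. P F \<Longrightarrow> P F' \<Longrightarrow> dist (sum g F) (sum g F') < (e/2)\<^sup>2" by blast
    from P obtain X where X: "finite X" "X \<subseteq> S"
      and PX: "\<And>F. finite F \<Longrightarrow> X \<subseteq> F \<Longrightarrow> F \<subseteq> S \<Longrightarrow> P F"
      unfolding eventually_finite_subsets_at_top by metis
    \<comment> \<open>Two large index sets need not be nested; passing through \<open>X\<close>,
      contained in both, makes each difference a single orthonormal sum.\<close>
    have close: "dist (sum ?f F) (sum ?f X) < e/2" if F: "finite F" "X \<subseteq> F" "F \<subseteq> S" for F
    proof -
      have "sum g (F - X) = sum g F - sum g X"
        using F X by (simp add: sum_diff)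
      also have "\<dots> < (e/2)\<^sup>2"
        using d[OF PX PX, of F X] F X by (simp add: dist_real_def)
      finally have "(norm (sum ?f (F - X)))\<^sup>2 < (e/2)\<^sup>2"
        using norm_orthonormal_sum[OF S, of "F - X" c] F by (simp add: g_def subset_iff)
      then have "norm (sum ?f (F - X)) < e/2"
        by (rule power2_less_imp_less) (use e in linarith)
      then show ?thesis
        using F X by (simp add: dist_norm sum_diff)
    qed
    show ?thesis
    proof (intro exI conjI allI impI)
      show "eventually (\<lambda>F. finite F \<and> X \<subseteq> F \<and> F \<subseteq> S) (finite_subsets_at_top S)"
        unfolding eventually_finite_subsets_at_top using X by (intro exI[of _ X]) simp
      fix F F' assume "(finite F \<and> X \<subseteq> F \<and> F \<subseteq> S) \<and> finite F' \<and> X \<subseteq> F' \<and> F' \<subseteq> S"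
      then show "dist (sum ?f F) (sum ?f F') < e"
        using close[of F] close[of F'] dist_triangle_half_l[of "sum ?f F" "sum ?f X" e "sum ?f F'"]
        by blast
    qed
  qed
  then have "cauchy_filter (filtermap (sum ?f) (finite_subsets_at_top S))"
    by (simp add: cauchy_filter_metric_filtermap)
  moreover have "complete (UNIV::'a set)"
    by (meson Cauchy_convergent UNIV_I complete_def convergent_def)
  ultimately obtain L' where "(sum ?f \<longlongrightarrow> L') (finite_subsets_at_top S)"
    using complete_uniform[where S=UNIV] by (force simp add: filterlim_def)
  then show ?thesis
    using summable_on_def has_sum_def by blast
qed

lemma cinner_orthonormal_has_sum:
  fixes S :: "'a::chilbert_space set"
  assumes S: "orthonormal S" and y: "((\<lambda>s. c s *\<^sub>C s) has_sum y) S" and t: "t \<in> S"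
  shows "cinner t y = c t"
proof -
  have "((\<lambda>s. cinner t (c s *\<^sub>C s)) has_sum cinner t y) S"
    by (rule has_sum_bounded_linear[OF bounded_linear_cinner_right y])
  moreover have "((\<lambda>s. cinner t (c s *\<^sub>C s)) has_sum c t) S"
    by (rule has_sum_finite_neutralI[of "{t}"])
      (use S t in \<open>auto simp: cinner_scaleC_right orthonormalD\<close>)
  ultimately show ?thesis by (rule has_sum_unique)
qed

section \<open>Bessel's inequality, Fourier expansion and Parseval's identity\<close>

lemma bessel_finite:
  assumes S: "orthonormal S" and F: "finite F" "F \<subseteq> S"
  shows "(\<Sum>s\<in>F. (cmod (cinner s x))\<^sup>2) \<le> (norm x)\<^sup>2"
proof -
  define p where "p = (\<Sum>s\<in>F. cinner s x *\<^sub>C s)"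
  have np: "(norm p)\<^sup>2 = (\<Sum>s\<in>F. (cmod (cinner s x))\<^sup>2)"
    unfolding p_def by (rule norm_orthonormal_sum[OF S F])
  have "cinner p x = (\<Sum>s\<in>F. cnj (cinner s x) * cinner s x)"
    unfolding p_def by (subst cinner_sum_left) (simp add: cinner_scaleC_left)
  also have "\<dots> = complex_of_real ((norm p)\<^sup>2)"
    unfolding np of_real_sum by (simp only: complex_norm_square mult.commute)
  finally have "inner p x = (norm p)\<^sup>2"
    unfolding Re_cinner[symmetric] by simp
  then have "(norm p)\<^sup>2 \<le> norm p * norm x"
    using norm_cauchy_schwarz[of p x] by simp
  then have "norm p \<le> norm x"
    by (cases "norm p = 0") (auto simp: power2_eq_square)
  then show ?thesis
    unfolding np[symmetric] by (simp add: power_mono)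
qed

lemma bessel_summable:
  assumes S: "orthonormal S"
  shows "(\<lambda>s. (cmod (cinner s x))\<^sup>2) summable_on S"
  by (rule nonneg_bdd_above_summable_on)
    (auto intro!: bdd_aboveI2[where M = "(norm x)\<^sup>2"] bessel_finite[OF S])

lemma fourier_summable:
  assumes S: "orthonormal S"
  shows "(\<lambda>s. cinner s x *\<^sub>C s) summable_on S"
  by (rule orthonormal_summable[OF S bessel_summable[OF S]])

text \<open>\<open>is_onb\<close> asks for maximality, not for a dense span. The Fourier series
  converges anyway, to some \<open>y\<close>, and \<open>x - y\<close> is orthogonal to
  \<open>B\<close>, hence zero.\<close>

lemma onb_expansion:
  assumes B: "is_onb B"
  shows "((\<lambda>b. cinner b x *\<^sub>C b) has_sum x) B"
proof -
  note on = is_onb_orthonormal[OF B]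
  obtain y where y: "((\<lambda>b. cinner b x *\<^sub>C b) has_sum y) B"
    using fourier_summable[OF on] unfolding summable_on_def by blast
  have "\<forall>b\<in>B. cinner b (x - y) = 0"
    using cinner_orthonormal_has_sum[OF on y] by (simp add: cinner_diff_right)
  then have "x - y = 0" using B unfolding is_onb_def by blast
  with y show ?thesis by simp
qed

lemma parseval:
  assumes B: "is_onb B"
  shows "((\<lambda>b. cinner x b * cinner b y) has_sum cinner x y) B"
  using has_sum_bounded_linear[OF bounded_linear_cinner_right[of x] onb_expansion[OF B, of y]]
  by (simp add: cinner_scaleC_right mult.commute)

lemma parseval_norm:
  assumes B: "is_onb B"
  shows "((\<lambda>b. (cmod (cinner b x))\<^sup>2) has_sum (norm x)\<^sup>2) B"
proof -
  have "((\<lambda>b. complex_of_real ((cmod (cinner b x))\<^sup>2)) has_sum complex_of_real ((norm x)\<^sup>2)) B"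
    using parseval[OF B, of x x] by (simp only: cinner_mult_commute cinner_self)
  then show ?thesis by (simp only: has_sum_of_real_iff)
qed

text \<open>Cauchy-Schwarz for finite sums, then Bessel. The bound is uniform in \<open>F\<close>,
  which yields the absolute summability behind every interchange of sums in a trace.\<close>

lemma sum_cmod_cinner_le:
  assumes S: "orthonormal S" and F: "finite F" "F \<subseteq> S"
  shows "(\<Sum>s\<in>F. cmod (cinner x s * cinner s y)) \<le> norm x * norm y"
proof -
  have "(\<Sum>s\<in>F. cmod (cinner x s * cinner s y))
      = (\<Sum>s\<in>F. \<bar>cmod (cinner s x)\<bar> * \<bar>cmod (cinner s y)\<bar>)"
    by (simp add: norm_mult cmod_cinner_commute[of x])
  also have "\<dots> \<le> L2_set (\<lambda>s. cmod (cinner s x)) F * L2_set (\<lambda>s. cmod (cinner s y)) F"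
    by (rule L2_set_mult_ineq)
  also have "\<dots> \<le> norm x * norm y"
    unfolding L2_set_def
    by (intro mult_mono real_le_lsqrt bessel_finite[OF S F] sum_nonneg) (auto intro: sum_nonneg)
  finally show ?thesis .
qed

lemma
  assumes S: "orthonormal S"
  shows abs_summable_cinner: "(\<lambda>s. cmod (cinner x s * cinner s y)) summable_on S"
    and infsum_cmod_cinner_le: "(\<Sum>\<^sub>\<infinity>s\<in>S. cmod (cinner x s * cinner s y)) \<le> norm x * norm y"
proof -
  show *: "(\<lambda>s. cmod (cinner x s * cinner s y)) summable_on S"
  proof (rule nonneg_bdd_above_summable_on)
    show "bdd_above (sum (\<lambda>s. cmod (cinner x s * cinner s y)) ` {F. F \<subseteq> S \<and> finite F})"
      by (rule bdd_aboveI2[where M = "norm x * norm y"]) (use sum_cmod_cinner_le[OF S] in blast)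
  qed simp
  show "(\<Sum>\<^sub>\<infinity>s\<in>S. cmod (cinner x s * cinner s y)) \<le> norm x * norm y"
    by (rule infsum_le_finite_sums[OF *]) (rule sum_cmod_cinner_le[OF S])
qed

text \<open>Zorn's lemma with a side condition: a trivial \<open>P\<close> yields orthonormal bases,
  and the property of being an eigenvector yields the eigenbasis.\<close>

lemma maximal_orthonormal_extension:
  fixes S :: "'a::chilbert_space set"
  assumes S: "orthonormal S" "\<And>s. s \<in> S \<Longrightarrow> P s"
  obtains B where "S \<subseteq> B" "orthonormal B" "\<And>b. b \<in> B \<Longrightarrow> P b"
    "\<And>x. P x \<Longrightarrow> norm x = 1 \<Longrightarrow> \<forall>b\<in>B. cinner b x = 0 \<Longrightarrow> False"
proof -
  define \<A> where "\<A> = {B. S \<subseteq> B \<and> orthonormal B \<and> (\<forall>b\<in>B. P b)}"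
  have "\<exists>M\<in>\<A>. \<forall>X\<in>\<A>. M \<subseteq> X \<longrightarrow> X = M"
  proof (rule subset_Zorn_nonempty)
    show "\<A> \<noteq> {}" using S by (auto simp: \<A>_def)
    fix \<C> assume C: "\<C> \<noteq> {}" "subset.chain \<A> \<C>"
    then have sub: "\<C> \<subseteq> \<A>" and tot: "\<And>X Y. X \<in> \<C> \<Longrightarrow> Y \<in> \<C> \<Longrightarrow> X \<subseteq> Y \<or> Y \<subseteq> X"
      by (auto simp: subset_chain_def)
    have "orthonormal (\<Union>\<C>)"
      unfolding orthonormal_def
    proof (intro ballI)
      fix x y assume "x \<in> \<Union>\<C>" "y \<in> \<Union>\<C>"
      then obtain X where "X \<in> \<C>" "x \<in> X" "y \<in> X" using tot by blast
      then show "cinner x y = (if x = y then 1 else 0)"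
        using sub orthonormalD[of X] by (auto simp: \<A>_def)
    qed
    then show "\<Union>\<C> \<in> \<A>" using C(1) sub by (fastforce simp: \<A>_def)
  qed
  then obtain B where B: "B \<in> \<A>" and max: "\<And>X. X \<in> \<A> \<Longrightarrow> B \<subseteq> X \<Longrightarrow> X = B" by blast
  show ?thesis
  proof (rule that)
    show "S \<subseteq> B" "orthonormal B" "\<And>b. b \<in> B \<Longrightarrow> P b" using B by (auto simp: \<A>_def)
    fix x assume x: "P x" "norm x = 1" "\<forall>b\<in>B. cinner b x = 0"
    then have xx: "cinner x x = 1" and xb: "\<forall>b\<in>B. cinner x b = 0"
      using cinner_commute[of x] by (auto simp: cinner_self)
    have "insert x B \<in> \<A>"
      using B x xx xb by (auto simp: \<A>_def orthonormal_def)
    then have "x \<in> B" using max by blast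
    then show False using x xx by auto
  qed
qed

text \<open>Taken at the empty set this provides an orthonormal basis. Without one,
  \<open>has_trace\<close> would be vacuous and \<open>op_trace\<close> undetermined.\<close>

lemma onb_extension:
  fixes S :: "'a::chilbert_space set"
  assumes "orthonormal S"
  obtains B where "S \<subseteq> B" "is_onb B"
proof -
  obtain B where B: "S \<subseteq> B" "orthonormal B"
    and max: "\<And>x. norm x = 1 \<Longrightarrow> \<forall>b\<in>B. cinner b x = 0 \<Longrightarrow> False"
  proof (rule maximal_orthonormal_extension[OF assms, of "\<lambda>_. True"])
    show True by (rule TrueI)
  qed (rule that, simp_all)
  have "x = 0" if "\<forall>b\<in>B. cinner b x = 0" for x
  proof (rule ccontr)
    assume "x \<noteq> 0"
    then show False
      using that by (intro max[of "x /\<^sub>R norm x"]) (simp_all add: cinner_scaleR_right)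
  qed
  with B that show ?thesis unfolding is_onb_def orthonormal_def by blast
qed

section \<open>Eigenbases of positive operators of finite trace\<close>

locale positive_operator =
  fixes A :: "'a::chilbert_space \<Rightarrow> 'a"
  assumes bounded_linear: "bounded_linear A"
    and scaleC: "A (c *\<^sub>C x) = c *\<^sub>C A x"
    and selfadjoint: "cinner x (A y) = cinner (A x) y"
    and nonneg: "0 \<le> Re (cinner x (A x))"
begin

sublocale bounded_linear A
  by (rule bounded_linear)

lemma inner_selfadjoint: "inner x (A y) = inner (A x) y"
  by (metis Re_cinner selfadjoint)

text \<open>The operator inequality A^2 <= K A without square roots: positivity is tested at
  \<open>x - (1/K) *\<^sub>R A x\<close>, where the quadratic term cancels at most half of the mixed
  ones. It turns summability of the diagonal into summability of
  \<open>(norm (A b))\<^sup>2\<close>.\<close>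

lemma norm_sq_le:
  assumes K: "K > 0" "\<And>x. norm (A x) \<le> K * norm x"
  shows "(norm (A x))\<^sup>2 \<le> K * inner x (A x)"
proof -
  define y where "y = x - (1/K) *\<^sub>R A x"
  have "0 \<le> inner y (A y)"
    using nonneg[of y] by (simp only: Re_cinner)
  also have "inner y (A y)
      = inner x (A x) - 2 / K * (norm (A x))\<^sup>2 + (1/K)\<^sup>2 * inner (A x) (A (A x))"
  proof -
    have "inner x (A (A x)) = (norm (A x))\<^sup>2"
      by (simp add: inner_selfadjoint power2_norm_eq_inner)
    moreover have "inner (A x) (A x) = (norm (A x))\<^sup>2"
      by (simp add: power2_norm_eq_inner)
    ultimately show ?thesis
      unfolding y_def diff scaleR inner_diff_left inner_diff_right inner_scaleR_left inner_scaleR_right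
      by (simp only:) (simp add: diff_divide_distrib power2_eq_square)
  qed
  also have "inner (A x) (A (A x)) \<le> K * (norm (A x))\<^sup>2"
    using norm_cauchy_schwarz[of "A x" "A (A x)"] mult_left_mono[OF K(2)[of "A x"], of "norm (A x)"]
    by (simp add: power2_eq_square mult_ac)
  then have "(1/K)\<^sup>2 * inner (A x) (A (A x)) \<le> (1/K)\<^sup>2 * (K * (norm (A x))\<^sup>2)"
    by (rule mult_left_mono) simp
  finally have "0 \<le> inner x (A x) - 2 / K * (norm (A x))\<^sup>2 + (1/K)\<^sup>2 * (K * (norm (A x))\<^sup>2)"
    by simp
  also have "\<dots> = inner x (A x) - (norm (A x))\<^sup>2 / K"
    using K(1) by (simp add: field_simps power2_eq_square)
  finally show ?thesis
    using K(1) by (simp add: field_simps)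
qed

lemma has_sum_expansion:
  assumes "is_onb B"
  shows "((\<lambda>b. cinner b x *\<^sub>C A b) has_sum A x) B"
  using has_sum_bounded_linear[OF bounded_linear onb_expansion[OF assms, of x]]
  by (simp add: scaleC)

text \<open>A quantitative form of compactness.\<close>

lemma norm_le_finite_coefficients:
  assumes B: "is_onb B" and tr: "(\<lambda>b. inner b (A b)) summable_on B" and \<delta>: "\<delta> > 0"
  obtains F C where "finite F" "C \<ge> 0"
    "\<And>x. norm (A x) \<le> C * (\<Sum>b\<in>F. cmod (cinner b x)) + \<delta> * norm x"
proof -
  note on = is_onb_orthonormal[OF B]
  obtain K where K: "K > 0" "\<And>x. norm (A x) \<le> K * norm x"
    using pos_bounded by (auto simp: mult.commute)
  define g where "g b = (norm (A b))\<^sup>2" for b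
  have "(\<lambda>b. K * inner b (A b)) summable_on B"
    by (rule summable_on_cmult_right[OF tr])
  then have g: "g summable_on B"
    by (rule summable_on_comparison_test) (auto simp: g_def intro: norm_sq_le[OF K])
  \<comment> \<open>Outside \<open>F\<close> the squared norms of the \<open>A b\<close> add up to
    at most \<open>\<delta>\<^sup>2\<close>; by Cauchy-Schwarz \<open>A\<close> then has norm at
    most \<open>\<delta>\<close> on the orthogonal complement of \<open>F\<close>.\<close>
  obtain F where F: "finite F" "F \<subseteq> B" and gF: "dist (sum g F) (infsum g B) \<le> \<delta>\<^sup>2"
    using infsum_finite_approximation[OF g, of "\<delta>\<^sup>2"] \<delta> by auto
  have small: "norm (A x) \<le> \<delta> * norm x" if x: "\<And>b. b \<in> F \<Longrightarrow> cinner b x = 0" for x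
  proof -
    have "norm (\<Sum>b\<in>G. cinner b x *\<^sub>C A b) \<le> \<delta> * norm x" if G: "finite G" "G \<subseteq> B" for G
    proof -
      have "(\<Sum>b\<in>G. cinner b x *\<^sub>C A b) = (\<Sum>b\<in>G - F. cinner b x *\<^sub>C A b)"
        by (rule sum.mono_neutral_right) (use G x in auto)
      also have "norm \<dots> \<le> (\<Sum>b\<in>G - F. \<bar>cmod (cinner b x)\<bar> * \<bar>norm (A b)\<bar>)"
        by (rule sum_norm_le) (simp add: norm_scaleC)
      also have "\<dots> \<le> L2_set (\<lambda>b. cmod (cinner b x)) (G - F) * L2_set (\<lambda>b. norm (A b)) (G - F)"
        by (rule L2_set_mult_ineq)
      also have "\<dots> \<le> norm x * \<delta>"
      proof (rule mult_mono)
        show "L2_set (\<lambda>b. cmod (cinner b x)) (G - F) \<le> norm x"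
          unfolding L2_set_def
          by (rule real_le_lsqrt) (use G bessel_finite[OF on, of "G - F" x] in \<open>auto intro: sum_nonneg\<close>)
        have "sum g (G - F) + sum g F = sum g (G \<union> F)"
          using G F by (subst sum.union_disjoint[symmetric]) (auto intro!: sum.cong)
        also have "\<dots> \<le> infsum g B"
          by (rule finite_sum_le_infsum[OF g]) (use G F in \<open>auto simp: g_def\<close>)
        finally have "sum g (G - F) \<le> \<delta>\<^sup>2"
          using gF by (simp add: dist_real_def)
        then show "L2_set (\<lambda>b. norm (A b)) (G - F) \<le> \<delta>"
          unfolding L2_set_def g_def
          by (intro real_le_lsqrt) (use \<delta> in \<open>auto intro: sum_nonneg\<close>)
      qed (auto simp: L2_set_nonneg)
      finally show ?thesis by (simp add: mult.commute)
    qed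
    then have "eventually (\<lambda>G. norm (\<Sum>b\<in>G. cinner b x *\<^sub>C A b) \<le> \<delta> * norm x) (finite_subsets_at_top B)"
      by (intro eventually_finite_subsets_at_top_weakI) auto
    moreover have "((\<lambda>G. norm (\<Sum>b\<in>G. cinner b x *\<^sub>C A b)) \<longlongrightarrow> norm (A x)) (finite_subsets_at_top B)"
      using has_sum_expansion[OF B, of x] unfolding has_sum_def by (rule tendsto_norm)
    ultimately show ?thesis
      by (rule tendsto_upperbound[OF _ _ finite_subsets_at_top_neq_bot, rotated])
  qed
  \<comment> \<open>In the constant \<open>K + \<delta>\<close>, \<open>K\<close> bounds
    \<open>A\<close> on the projection \<open>p\<close>, and \<open>\<delta>\<close> pays for
    \<open>norm p\<close> in \<open>norm (x - p) \<le> norm x + norm p\<close>.\<close>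
  have "norm (A x) \<le> (K + \<delta>) * (\<Sum>b\<in>F. cmod (cinner b x)) + \<delta> * norm x" for x
  proof -
    define p where "p = (\<Sum>b\<in>F. cinner b x *\<^sub>C b)"
    have np: "norm p \<le> (\<Sum>b\<in>F. cmod (cinner b x))"
      unfolding p_def
      by (rule sum_norm_le) (use F orthonormal_norm[OF on] in \<open>auto simp: norm_scaleC\<close>)
    have "norm (A x) \<le> norm (A p) + norm (A (x - p))"
      using norm_triangle_ineq[of "A p" "A (x - p)"] by (simp add: diff)
    also have "norm (A (x - p)) \<le> \<delta> * norm (x - p)"
      by (rule small) (use F cinner_orthonormal_sum[OF on F] in \<open>auto simp: cinner_diff_right p_def\<close>)
    also have "norm (x - p) \<le> norm x + norm p"
      by (rule norm_triangle_ineq4)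
    also have "norm (A p) \<le> K * norm p"
      by (rule K)
    finally have "norm (A x) \<le> (K + \<delta>) * norm p + \<delta> * norm x"
      using \<delta> by (simp add: algebra_simps)
    also have "\<dots> \<le> (K + \<delta>) * (\<Sum>b\<in>F. cmod (cinner b x)) + \<delta> * norm x"
      using np K(1) \<delta> by (intro add_right_mono mult_left_mono) auto
    finally show ?thesis .
  qed
  with that[of F "K + \<delta>"] F(1) K(1) \<delta> show ?thesis by simp
qed

text \<open>The vector z = (A - m) y satisfies A z = - m z, which positivity of \<open>A\<close>
  allows only for z = 0.\<close>

lemma eigenvector_of_square:
  assumes "A (A y) = m\<^sup>2 *\<^sub>R y" "m > 0"
  shows "A y = m *\<^sub>R y"
proof -
  define z where "z = A y - m *\<^sub>R y"
  have "A z = - (m *\<^sub>R z)"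
    using assms(1) by (simp add: z_def diff scaleR algebra_simps power2_eq_square)
  then have "0 \<le> - (m * (norm z)\<^sup>2)"
    using nonneg[of z] by (simp add: Re_cinner power2_norm_eq_inner)
  then have "(norm z)\<^sup>2 \<le> 0"
    using assms(2) by (simp add: mult_le_0_iff)
  then show ?thesis by (simp add: z_def)
qed

text \<open>Vectors nearly attaining \<open>m = sup |A x|\<close> nearly satisfy \<open>A\<^sup>2 x = m\<^sup>2 x\<close>. Controlling
  finitely many of their coefficients makes them a Cauchy sequence, whose limit is the eigenvector.\<close>

lemma eigenvector_perp_exists:
  assumes B: "is_onb B" and tr: "(\<lambda>b. inner b (A b)) summable_on B"
    and S: "\<And>s. s \<in> S \<Longrightarrow> \<exists>l. A s = l *\<^sub>R s"
    and w: "\<And>s. s \<in> S \<Longrightarrow> cinner s w = 0" "A w \<noteq> 0"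
  obtains y l where "\<And>s. s \<in> S \<Longrightarrow> cinner s y = 0" "norm y = 1" "A y = l *\<^sub>R y"
proof -
  \<comment> \<open>The orthogonal complement of the eigenvectors in \<open>S\<close>, which
    \<open>A\<close> maps into itself by self-adjointness; the new eigenvector is sought inside
    it.\<close>
  define W where "W = {x. \<forall>s\<in>S. cinner s x = 0}"
  have W_scale: "r *\<^sub>R x \<in> W" if "x \<in> W" for r x
    using that by (auto simp: W_def cinner_scaleR_right)
  have W_A: "A x \<in> W" if "x \<in> W" for x
    unfolding W_def
  proof safe
    fix s assume "s \<in> S"
    then obtain l where "A s = l *\<^sub>R s" using S by blast
    then show "cinner s (A x) = 0"
      using that \<open>s \<in> S\<close> by (simp add: selfadjoint cinner_scaleR_left W_def)
  qed
  obtain K where K: "\<And>x. norm (A x) \<le> norm x * K" using bounded by blast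
  define X where "X = (\<lambda>x. norm (A x)) ` {x \<in> W. norm x = 1}"
  define m where "m = Sup X"
  have X: "bdd_above X"
    unfolding X_def
  proof (rule bdd_aboveI2)
    fix x assume "x \<in> {x \<in> W. norm x = 1}"
    then show "norm (A x) \<le> K" using K[of x] by simp
  qed
  have m_bound: "norm (A x) \<le> m * norm x" if "x \<in> W" for x
  proof (cases "x = 0")
    case False
    then have "norm (A (x /\<^sub>R norm x)) \<in> X"
      unfolding X_def using W_scale[OF that] by (intro imageI) simp
    then have "norm (A (x /\<^sub>R norm x)) \<le> m"
      unfolding m_def by (rule cSup_upper[OF _ X])
    then show ?thesis using False by (simp add: scaleR field_simps)
  qed (simp add: zero)
  have w_W: "w \<in> W" using w(1) by (simp add: W_def)
  have m: "m > 0"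
  proof (rule ccontr)
    assume "\<not> m > 0"
    then have "m * norm w \<le> 0" by (simp add: mult_le_0_iff)
    with m_bound[OF w_W] have "norm (A w) \<le> 0" by linarith
    then show False using w(2) by simp
  qed
  have w0: "w \<noteq> 0" using w(2) zero by auto
  have "w /\<^sub>R norm w \<in> {x \<in> W. norm x = 1}"
    using W_scale[OF w_W] w0 by simp
  then have "X \<noteq> {}" unfolding X_def by blast
  then have "\<exists>x. x \<in> W \<and> norm x = 1 \<and> m - 1 / Suc n < norm (A x)" for n
    using less_cSupD[of X "m - 1 / Suc n"] unfolding m_def[symmetric] by (force simp: X_def)
  then obtain x where x: "\<And>n. x n \<in> W" "\<And>n. norm (x n) = 1"
    and xm: "\<And>n. m - 1 / Suc n < norm (A (x n))" by metis
  have Ax_le: "norm (A (x n)) \<le> m" for n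
    using m_bound[OF x(1)] x(2) by simp
  have lim: "(\<lambda>n. norm (A (x n))) \<longlonglongrightarrow> m"
  proof (rule tendsto_sandwich[of "\<lambda>n. m - 1 / Suc n" _ _ "\<lambda>_. m"])
    show "(\<lambda>n. m - 1 / Suc n) \<longlonglongrightarrow> m"
      using tendsto_diff[OF tendsto_const LIMSEQ_Suc[OF lim_1_over_n], of m] by simp
  qed (use xm Ax_le in \<open>auto intro!: always_eventually less_imp_le\<close>)
  define r where "r n = A (A (x n)) - m\<^sup>2 *\<^sub>R x n" for n
  \<comment> \<open>The square of \<open>A\<close> is used because the mixed term in the expansion
    is then \<open>(norm (A (x n)))\<^sup>2\<close>, whose limit is known. The leading term is at
    most \<open>(m * m)\<^sup>2\<close>, as \<open>A (x n)\<close> stays in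
    \<open>W\<close>.\<close>
  have r_le: "(norm (r n))\<^sup>2 \<le> 2 * m\<^sup>2 * (m\<^sup>2 - (norm (A (x n)))\<^sup>2)" for n
  proof -
    have "norm (A (A (x n))) \<le> m * m"
      using order_trans[OF m_bound[OF W_A[OF x(1)[of n]]] mult_left_mono[OF Ax_le[of n]]] m by simp
    then have le: "(norm (A (A (x n))))\<^sup>2 \<le> (m * m)\<^sup>2"
      by (rule power_mono) simp
    have "inner (A (A (x n))) (x n) = (norm (A (x n)))\<^sup>2"
      by (simp add: inner_selfadjoint[symmetric] power2_norm_eq_inner)
    moreover have "(norm (r n))\<^sup>2 = (norm (A (A (x n))))\<^sup>2 - 2 * (m\<^sup>2 * inner (A (A (x n))) (x n))
        + m\<^sup>2 * m\<^sup>2 * (norm (x n))\<^sup>2"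
      unfolding r_def power2_norm_eq_inner inner_diff_left inner_diff_right inner_scaleR_left
        inner_scaleR_right inner_commute[of "x n" "A (A (x n))"] by (simp add: right_diff_distrib)
    ultimately have "(norm (r n))\<^sup>2
        = (norm (A (A (x n))))\<^sup>2 - 2 * (m\<^sup>2 * (norm (A (x n)))\<^sup>2) + m\<^sup>2 * m\<^sup>2"
      using x(2)[of n] by simp
    moreover have "(m * m)\<^sup>2 = m\<^sup>2 * m\<^sup>2" by (rule power_mult_distrib)
    ultimately show ?thesis using le by (simp only: right_diff_distrib mult.assoc)
  qed
  have "(\<lambda>n. 2 * m\<^sup>2 * (m\<^sup>2 - (norm (A (x n)))\<^sup>2)) \<longlonglongrightarrow> 2 * m\<^sup>2 * (m\<^sup>2 - m\<^sup>2)"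
    by (intro tendsto_intros lim)
  then have "(\<lambda>n. 2 * m\<^sup>2 * (m\<^sup>2 - (norm (A (x n)))\<^sup>2)) \<longlonglongrightarrow> 0" by simp
  then have "(\<lambda>n. (norm (r n))\<^sup>2) \<longlonglongrightarrow> 0"
    by (rule tendsto_sandwich[OF _ _ tendsto_const, rotated 2])
      (use r_le in \<open>simp_all add: always_eventually\<close>)
  from tendsto_real_sqrt[OF this] have r: "(\<lambda>n. norm (r n)) \<longlonglongrightarrow> 0" by simp
  obtain F C where F: "finite F" and C: "C \<ge> 0"
    and FC: "\<And>x. norm (A x) \<le> C * (\<Sum>b\<in>F. cmod (cinner b x)) + m / 2 * norm x"
    using norm_le_finite_coefficients[OF B tr, of "m / 2"] m by auto
  define M where "M = Max (insert 0 (norm ` F))"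
  have "cmod (cinner b (x n)) \<le> M" if "b \<in> F" for b n
    using order_trans[OF cmod_cinner_le, of b "x n" M] x(2)[of n] F that by (simp add: M_def)
  then obtain k where k: "strict_mono (k :: nat \<Rightarrow> nat)"
    and "\<And>b. b \<in> F \<Longrightarrow> \<exists>l. (\<lambda>n. cinner b (x (k n))) \<longlonglongrightarrow> l"
    using function_convergent_subsequence[OF countable_finite[OF F], of "\<lambda>n b. cinner b (x n)" M] by metis
  then obtain l where l: "\<And>b. b \<in> F \<Longrightarrow> (\<lambda>n. cinner b (x (k n))) \<longlonglongrightarrow> l b" by metis
  define P where "P n = (\<Sum>b\<in>F. cmod (cinner b (x (k n)) - l b))" for n
  define d where "d n = m * C * P n + norm (r (k n))" for n
  have "d \<longlonglongrightarrow> m * C * (\<Sum>b\<in>F. cmod (l b - l b)) + 0"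
    unfolding d_def P_def by (intro tendsto_intros l LIMSEQ_subseq_LIMSEQ[OF r k, unfolded comp_def])
  then have d0: "d \<longlonglongrightarrow> 0" by simp
  \<comment> \<open>Up to two residuals \<open>m\<^sup>2 *\<^sub>R u\<close> equals
    \<open>A (A u)\<close>, whose norm is at most \<open>m * norm (A u)\<close>. The choice of
    \<open>m / 2\<close> in \<open>FC\<close> bounds this by convergent coefficients plus
    \<open>m\<^sup>2 / 2 * norm u\<close>, which is absorbed on the left.\<close>
  have dist: "m\<^sup>2 / 2 * norm (x (k i) - x (k j)) \<le> d i + d j" for i j
  proof -
    define u where "u = x (k i) - x (k j)"
    have u: "u \<in> W" using x(1) by (auto simp: u_def W_def cinner_diff_right)
    have "m\<^sup>2 *\<^sub>R u = A (A u) - r (k i) + r (k j)"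
      by (simp add: u_def r_def diff algebra_simps)
    then have "m\<^sup>2 * norm u = norm (A (A u) - r (k i) + r (k j))"
      by (metis norm_scaleR abs_of_nonneg zero_le_power2)
    also have "\<dots> \<le> norm (A (A u)) + norm (r (k i)) + norm (r (k j))"
      by (meson norm_triangle_ineq norm_triangle_ineq4 add_mono order_refl order_trans)
    finally have 1: "m\<^sup>2 * norm u \<le> norm (A (A u)) + norm (r (k i)) + norm (r (k j))" .
    have 2: "norm (A (A u)) \<le> m * norm (A u)"
      by (rule m_bound[OF W_A[OF u]])
    have "cmod (cinner b u) \<le> cmod (cinner b (x (k i)) - l b) + cmod (cinner b (x (k j)) - l b)" for b
      using norm_triangle_ineq4[of "cinner b (x (k i)) - l b" "cinner b (x (k j)) - l b"]
      by (simp add: u_def cinner_diff_right)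
    then have "(\<Sum>b\<in>F. cmod (cinner b u)) \<le> P i + P j"
      unfolding P_def sum.distrib[symmetric] by (rule sum_mono)
    then have "C * (\<Sum>b\<in>F. cmod (cinner b u)) \<le> C * (P i + P j)"
      using C by (rule mult_left_mono)
    then have "norm (A u) \<le> C * (P i + P j) + m / 2 * norm u"
      using FC[of u] by linarith
    then have "m * norm (A u) \<le> m * (C * (P i + P j) + m / 2 * norm u)"
      using m by (intro mult_left_mono) auto
    also have "\<dots> = m * C * P i + m * C * P j + m\<^sup>2 / 2 * norm u"
      by (simp add: algebra_simps power2_eq_square)
    finally show ?thesis
      using 1 2 unfolding d_def u_def[symmetric] by linarith
  qed
  have "Cauchy (\<lambda>n. x (k n))"
  proof (rule metric_CauchyI)
    fix e :: real assume e: "e > 0"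
    then obtain N where N: "\<And>n. n \<ge> N \<Longrightarrow> norm (d n - 0) < m\<^sup>2 / 4 * e"
      using LIMSEQ_D[OF d0, of "m\<^sup>2 / 4 * e"] m by auto
    show "\<exists>N. \<forall>i\<ge>N. \<forall>j\<ge>N. dist (x (k i)) (x (k j)) < e"
    proof (intro exI allI impI)
      fix i j assume "i \<ge> N" "j \<ge> N"
      then have "m\<^sup>2 / 2 * norm (x (k i) - x (k j)) < m\<^sup>2 / 2 * e"
        using dist[of i j] N[of i] N[of j] by simp
      then show "dist (x (k i)) (x (k j)) < e" using m by (simp add: dist_norm)
    qed
  qed
  then obtain y where y: "(\<lambda>n. x (k n)) \<longlonglongrightarrow> y"
    using Cauchy_convergent convergent_def by blast
  have Ay: "(\<lambda>n. A (A (x (k n)))) \<longlonglongrightarrow> A (A y)"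
    by (intro tendsto y)
  have "(\<lambda>n. r (k n)) \<longlonglongrightarrow> A (A y) - m\<^sup>2 *\<^sub>R y"
    unfolding r_def by (intro tendsto_intros Ay y)
  moreover have "(\<lambda>n. r (k n)) \<longlonglongrightarrow> 0"
    using LIMSEQ_subseq_LIMSEQ[OF r k] by (simp add: tendsto_norm_zero_iff comp_def)
  ultimately have "A (A y) = m\<^sup>2 *\<^sub>R y"
    using LIMSEQ_unique by fastforce
  then have "A y = m *\<^sub>R y" by (rule eigenvector_of_square[OF _ m])
  moreover have "norm y = 1"
    using LIMSEQ_unique[OF tendsto_norm[OF y]] x(2) by simp
  moreover have "cinner s y = 0" if "s \<in> S" for s
    using LIMSEQ_unique[OF bounded_linear.tendsto[OF bounded_linear_cinner_right y, of s]] x(1) that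
    by (simp add: W_def)
  ultimately show ?thesis using that by blast
qed

text \<open>A maximal orthonormal set of eigenvectors is a basis: a nonzero vector orthogonal to it
  either lies in the kernel, and is then itself a further eigenvector after normalisation, or
  witnesses that \<open>A\<close> does not vanish on the orthogonal complement, where a further
  eigenvector then exists.\<close>

theorem eigenbasis_exists:
  assumes tr: "has_trace A t"
  obtains S where "is_onb S" "\<And>s. s \<in> S \<Longrightarrow> \<exists>l. A s = l *\<^sub>R s"
proof -
  obtain B :: "'a set" where B: "is_onb B"
    using onb_extension[of "{}"] by (auto simp: orthonormal_def)
  have "((\<lambda>b. cinner b (A b)) has_sum t) B"
    using tr B by (simp add: has_trace_def)
  from has_sum_Re[OF this] have trB: "(\<lambda>b. inner b (A b)) summable_on B"
    by (auto simp: Re_cinner summable_on_def)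
  obtain S where S: "orthonormal S" "\<And>s. s \<in> S \<Longrightarrow> \<exists>l. A s = l *\<^sub>R s"
    and max: "\<And>x. \<exists>l. A x = l *\<^sub>R x \<Longrightarrow> norm x = 1 \<Longrightarrow> \<forall>s\<in>S. cinner s x = 0 \<Longrightarrow> False"
  proof (rule maximal_orthonormal_extension[of "{}" "\<lambda>x. \<exists>l. A x = l *\<^sub>R x"])
    show "orthonormal ({} :: 'a set)" by (simp add: orthonormal_def)
  qed (use that in auto)
  have "x = 0" if x: "\<forall>s\<in>S. cinner s x = 0" for x
  proof (rule ccontr)
    assume x0: "x \<noteq> 0"
    show False
    proof (cases "A x = 0")
      case True
      show False
      proof (rule max)
        show "\<exists>l. A (x /\<^sub>R norm x) = l *\<^sub>R (x /\<^sub>R norm x)"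
          using True by (intro exI[of _ 0]) (simp add: scaleR)
      qed (use x x0 in \<open>auto simp: cinner_scaleR_right\<close>)
    next
      case False
      then obtain y l where "\<And>s. s \<in> S \<Longrightarrow> cinner s y = 0" "norm y = 1" "A y = l *\<^sub>R y"
        using eigenvector_perp_exists[OF B trB S(2)] x by metis
      then show False using max by blast
    qed
  qed
  with S have "is_onb S" unfolding is_onb_def orthonormal_def by blast
  with S(2) that show ?thesis by blast
qed

end

section \<open>Diagonal operators and functional calculus\<close>

text \<open>The common normal form of \<rho>, \<sigma> and their functions. Indexing by basis
  vectors instead of eigenvalues takes care of multiplicities. The series is known to converge for
  bounded \<open>a\<close>.\<close>

definition diag :: "'a::chilbert_space set \<Rightarrow> ('a \<Rightarrow> real) \<Rightarrow> 'a \<Rightarrow> 'a" where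
  "diag S a x = (\<Sum>\<^sub>\<infinity>s\<in>S. (complex_of_real (a s) * cinner s x) *\<^sub>C s)"

lemma diag_has_sum:
  fixes S :: "'a::chilbert_space set"
  assumes S: "orthonormal S" and K: "\<forall>s\<in>S. \<bar>a s\<bar> \<le> K"
  shows "((\<lambda>s. (complex_of_real (a s) * cinner s x) *\<^sub>C s) has_sum diag S a x) S"
proof -
  have "(\<lambda>s. K\<^sup>2 * (cmod (cinner s x))\<^sup>2) summable_on S"
    by (rule summable_on_cmult_right[OF bessel_summable[OF S]])
  then have "(\<lambda>s. (cmod (complex_of_real (a s) * cinner s x))\<^sup>2) summable_on S"
  proof (rule summable_on_comparison_test)
    fix s assume "s \<in> S"
    then have "\<bar>a s\<bar>\<^sup>2 \<le> K\<^sup>2"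
      using K by (intro power_mono) auto
    then show "(cmod (complex_of_real (a s) * cinner s x))\<^sup>2 \<le> K\<^sup>2 * (cmod (cinner s x))\<^sup>2"
      unfolding norm_mult power_mult_distrib by (intro mult_right_mono) auto
  qed simp
  from orthonormal_summable[OF S this] show ?thesis
    unfolding diag_def by (rule has_sum_infsum)
qed

lemma cinner_diag:
  assumes S: "orthonormal S" and K: "\<forall>s\<in>S. \<bar>a s\<bar> \<le> K" and s: "s \<in> S"
  shows "cinner s (diag S a x) = complex_of_real (a s) * cinner s x"
  by (rule cinner_orthonormal_has_sum[OF S diag_has_sum[OF S K] s])

lemma norm_diag_le:
  assumes S: "is_onb S" and K: "\<forall>s\<in>S. \<bar>a s\<bar> \<le> K" "K \<ge> 0"
  shows "norm (diag S a x) \<le> K * norm x"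
proof -
  note on = is_onb_orthonormal[OF S]
  have "(norm (diag S a x))\<^sup>2 \<le> K\<^sup>2 * (norm x)\<^sup>2"
  proof (rule has_sum_mono[OF parseval_norm[OF S] has_sum_cmult_right[OF parseval_norm[OF S]]])
    fix s assume s: "s \<in> S"
    then have "\<bar>a s\<bar>\<^sup>2 \<le> K\<^sup>2"
      using K by (intro power_mono) auto
    then show "(cmod (cinner s (diag S a x)))\<^sup>2 \<le> K\<^sup>2 * (cmod (cinner s x))\<^sup>2"
      unfolding cinner_diag[OF on K(1) s] norm_mult power_mult_distrib
      by (intro mult_right_mono) auto
  qed
  then have "(norm (diag S a x))\<^sup>2 \<le> (K * norm x)\<^sup>2"
    by (simp only: power_mult_distrib)
  then show ?thesis
    by (rule power2_le_imp_le) (use K(2) in simp)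
qed

lemma diag_has_sum_cinner:
  assumes S: "orthonormal S" and K: "\<forall>s\<in>S. \<bar>a s\<bar> \<le> K"
  shows "((\<lambda>s. complex_of_real (a s) * (cinner x s * cinner s y)) has_sum cinner x (diag S a y)) S"
  using has_sum_bounded_linear[OF bounded_linear_cinner_right diag_has_sum[OF S K], of x y]
  by (simp add: cinner_scaleC_right mult_ac)

lemma diag_selfadjoint:
  assumes S: "orthonormal S" and K: "\<forall>s\<in>S. \<bar>a s\<bar> \<le> K"
  shows "cinner x (diag S a y) = cinner (diag S a x) y"
proof -
  have "((\<lambda>s. cnj (complex_of_real (a s) * (cinner y s * cinner s x)))
      has_sum cnj (cinner y (diag S a x))) S"
    unfolding has_sum_cnj_iff by (rule diag_has_sum_cinner[OF S K])
  moreover have "cnj (complex_of_real (a s) * (cinner y s * cinner s x))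
      = complex_of_real (a s) * (cinner x s * cinner s y)" for s
    by (simp add: cinner_commute[of x s] cinner_commute[of s y])
  moreover have "cnj (cinner y (diag S a x)) = cinner (diag S a x) y"
    by (rule cinner_commute[symmetric])
  ultimately have "((\<lambda>s. complex_of_real (a s) * (cinner x s * cinner s y))
      has_sum cinner (diag S a x) y) S"
    by (simp only:)
  with diag_has_sum_cinner[OF S K] show ?thesis by (rule has_sum_unique)
qed

lemma diag_diff:
  fixes S :: "'a::chilbert_space set"
  assumes S: "orthonormal S" and K: "\<forall>s\<in>S. \<bar>a s\<bar> \<le> K" and L: "\<forall>s\<in>S. \<bar>b s\<bar> \<le> L"
  shows "diag S (\<lambda>s. a s - b s) x = diag S a x - diag S b x"
proof -
  have "(complex_of_real (a s - b s) * cinner s x) *\<^sub>C s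
      = (complex_of_real (a s) * cinner s x) *\<^sub>C s + - ((complex_of_real (b s) * cinner s x) *\<^sub>C s)" for s
    using linear_diff[OF bounded_linear.linear[OF bounded_linear_scaleC]]
    by (simp add: left_diff_distrib)
  then have "((\<lambda>s. (complex_of_real (a s - b s) * cinner s x) *\<^sub>C s) has_sum (diag S a x - diag S b x)) S"
    using has_sum_add[OF diag_has_sum[OF S K] has_sum_bounded_linear[OF
          bounded_linear_minus[OF bounded_linear_ident] diag_has_sum[OF S L]]] by simp
  then show ?thesis unfolding diag_def by (rule infsumI)
qed

lemma diag_one: "is_onb S \<Longrightarrow> diag S (\<lambda>_. 1) x = x"
  unfolding diag_def using infsumI[OF onb_expansion] by simp

section \<open>The functional calculus in an eigenbasis\<close>

context positive_operator
begin

lemma eq_diag: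
  assumes S: "is_onb S" and eig: "\<And>s. s \<in> S \<Longrightarrow> A s = lam s *\<^sub>R s"
  shows "A x = diag S lam x"
proof -
  have "((\<lambda>s. (complex_of_real (lam s) * cinner s x) *\<^sub>C s) has_sum A x) S"
    using has_sum_expansion[OF S, of x]
    by (rule has_sum_cong[THEN iffD1, rotated]) (simp add: eig scaleR_scaleC scaleC_scaleC mult.commute)
  then show ?thesis unfolding diag_def by (rule infsumI[symmetric])
qed

lemma eigenvalue_eq:
  assumes "A s = k *\<^sub>R s" "A x = l *\<^sub>R x" "cinner s x \<noteq> 0"
  shows "k = l"
  using selfadjoint[of s x] assms by (simp add: cinner_scaleR_left cinner_scaleR_right)

text \<open>\<open>orth_proj\<close> is a definite description, so the sum \<open>p\<close> must be
  shown to be the only candidate. Orthogonality of \<open>x - p\<close> to the eigenspace is checked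
  in coordinates: basis vectors with eigenvalue \<open>l\<close> are orthogonal to
  \<open>x - p\<close>, the others to the eigenspace.\<close>

lemma orth_proj_eigenspace:
  assumes S: "is_onb S" and eig: "\<And>s. s \<in> S \<Longrightarrow> A s = lam s *\<^sub>R s"
  shows "((\<lambda>s. cinner s x *\<^sub>C s) has_sum orth_proj (eigenspace A l) x) {s \<in> S. lam s = l}"
proof -
  let ?T = "{s \<in> S. lam s = l}"
  note on = is_onb_orthonormal[OF S]
  have onT: "orthonormal ?T" by (rule orthonormal_subset[OF on]) auto
  obtain p where p: "((\<lambda>s. cinner s x *\<^sub>C s) has_sum p) ?T"
    using fourier_summable[OF onT] unfolding summable_on_def by blast
  have "((\<lambda>s. A (cinner s x *\<^sub>C s)) has_sum A p) ?T"
    by (rule has_sum_bounded_linear[OF bounded_linear p])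
  then have "((\<lambda>s. l *\<^sub>R (cinner s x *\<^sub>C s)) has_sum A p) ?T"
    by (rule has_sum_cong[THEN iffD1, rotated])
      (auto simp: scaleC eig scaleR_scaleC scaleC_scaleC mult.commute)
  with has_sum_bounded_linear[OF bounded_linear_scaleR_right p]
  have pE: "p \<in> eigenspace A l"
    unfolding eigenspace_def using has_sum_unique by blast
  have perp: "cinner z (x - p) = 0" if z: "z \<in> eigenspace A l" for z
  proof -
    have "cinner z s * cinner s (x - p) = 0" if s: "s \<in> S" for s
    proof (cases "lam s = l")
      case True
      then have "cinner s p = cinner s x"
        using cinner_orthonormal_has_sum[OF onT p] s by simp
      then show ?thesis by (simp add: cinner_diff_right)
    next
      case False
      then have "cinner s z = 0"
        using eigenvalue_eq[OF eig[OF s], of z l] z by (auto simp: eigenspace_def)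
      then show ?thesis using cinner_commute[of z s] by simp
    qed
    then have "((\<lambda>s. cinner z s * cinner s (x - p)) has_sum 0) S"
      by (intro has_sum_0) auto
    then show ?thesis using parseval[OF S] has_sum_unique by blast
  qed
  have "orth_proj (eigenspace A l) x = p"
    unfolding orth_proj_def
  proof (rule the_equality)
    fix y assume y: "y \<in> eigenspace A l \<and> (\<forall>z\<in>eigenspace A l. cinner z (x - y) = 0)"
    then have "p - y \<in> eigenspace A l"
      using pE by (simp add: eigenspace_def diff scaleR_diff_right)
    then have "cinner (p - y) (x - y) - cinner (p - y) (x - p) = 0"
      using y perp by simp
    then have "cinner (p - y) (p - y) = 0"
      by (simp add: cinner_diff_right[symmetric])
    then show "y = p" by (simp add: cinner_self)
  qed (use pE perp in blast)
  with p show ?thesis by simp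
qed

text \<open>The fibres of \<open>lam\<close> partition \<open>S\<close>. The sum over
  \<open>S\<close> converges by boundedness, so it may be taken fibre by fibre, and each fibre gives
  \<open>f l\<close> times one spectral projection.\<close>

lemma fun_calc_eq_diag:
  assumes S: "is_onb S" and eig: "\<And>s. s \<in> S \<Longrightarrow> A s = lam s *\<^sub>R s"
    and K: "\<forall>s\<in>S. \<bar>f (lam s)\<bar> \<le> K"
  shows "fun_calc f A = diag S (\<lambda>s. f (lam s))"
proof
  fix x
  note on = is_onb_orthonormal[OF S]
  define L where "L = {l. eigenspace A l \<noteq> {0}}"
  have L: "lam s \<in> L" if "s \<in> S" for s
  proof -
    have "s \<in> eigenspace A (lam s)" using eig[OF that] by (simp add: eigenspace_def)
    moreover have "s \<noteq> 0" using orthonormal_norm[OF on that] by auto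
    ultimately show ?thesis unfolding L_def by blast
  qed
  let ?F = "\<lambda>s. (complex_of_real (f (lam s)) * cinner s x) *\<^sub>C s"
  have bij: "bij_betw snd (Sigma L (\<lambda>l. {s \<in> S. lam s = l})) S"
    by (rule bij_betw_byWitness[of _ "\<lambda>s. (lam s, s)"]) (use L in auto)
  have "((\<lambda>z. ?F (snd z)) has_sum diag S (\<lambda>s. f (lam s)) x) (Sigma L (\<lambda>l. {s \<in> S. lam s = l}))"
    using diag_has_sum[OF on, of "\<lambda>s. f (lam s)" K x] K
    by (subst has_sum_reindex_bij_betw[OF bij]) auto
  then have "((\<lambda>l. f l *\<^sub>R orth_proj (eigenspace A l) x) has_sum diag S (\<lambda>s. f (lam s)) x) L"
  proof (rule has_sum_SigmaD)
    fix l
    have "((\<lambda>s. f l *\<^sub>R (cinner s x *\<^sub>C s)) has_sum f l *\<^sub>R orth_proj (eigenspace A l) x) {s \<in> S. lam s = l}"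
      by (rule has_sum_bounded_linear[OF bounded_linear_scaleR_right orth_proj_eigenspace[OF S eig]])
    then show "((\<lambda>s. ?F (snd (l, s))) has_sum f l *\<^sub>R orth_proj (eigenspace A l) x) {s \<in> S. lam s = l}"
      by (rule has_sum_cong[THEN iffD1, rotated]) (auto simp: scaleR_scaleC scaleC_scaleC)
  qed
  then show "fun_calc f A x = diag S (\<lambda>s. f (lam s)) x"
    unfolding fun_calc_def L_def by (rule infsumI)
qed

end

section \<open>Traces\<close>

lemma has_trace_op_trace:
  fixes A :: "'a::chilbert_space \<Rightarrow> 'a"
  assumes "has_trace A t"
  shows "op_trace A = t"
  unfolding op_trace_def
proof (rule the_equality)
  show "has_trace A t" by (rule assms)
next
  fix u assume u: "has_trace A u"
  obtain B :: "'a set" where "is_onb B"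
    using onb_extension[of "{}"] by (auto simp: orthonormal_def)
  with assms u show "u = t"
    unfolding has_trace_def using has_sum_unique by blast
qed

lemma has_trace_add:
  assumes "has_trace A a" "has_trace B b"
  shows "has_trace (\<lambda>x. A x + B x) (a + b)"
  using assms by (auto simp: has_trace_def cinner_add_right intro: has_sum_add)

lemma has_trace_diff:
  fixes A B :: "'a::chilbert_space \<Rightarrow> 'a"
  assumes "has_trace A a" "has_trace B b"
  shows "has_trace (\<lambda>x. A x - B x) (a - b)"
  unfolding has_trace_def cinner_diff_right
proof (intro allI impI)
  fix S :: "'a set" assume "is_onb S"
  then have "((\<lambda>e. cinner e (A e)) has_sum a) S" "((\<lambda>e. cinner e (B e)) has_sum b) S"
    using assms by (auto simp: has_trace_def)
  from has_sum_add[OF this(1) has_sum_bounded_linear[OF bounded_linear_minus[OF bounded_linear_ident] this(2)]]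
  show "((\<lambda>e. cinner e (A e) - cinner e (B e)) has_sum a - b) S" by simp
qed

text \<open>The series of \<open>cmod (F (i, e))\<close> over \<open>e\<close> is at most
  \<open>norm (u i) * norm (v i)\<close>, so the double series converges absolutely in any basis.
  Summed over \<open>e\<close> first, Parseval gives \<open>t\<close>; summed over \<open>i\<close>
  first, it is the diagonal of \<open>A\<close>.\<close>

lemma has_trace_rank_one_series:
  fixes u v :: "'i \<Rightarrow> 'a::chilbert_space"
  assumes uv: "(\<lambda>i. norm (u i) * norm (v i)) summable_on I"
    and A: "\<And>x. ((\<lambda>i. cinner (v i) x *\<^sub>C u i) has_sum A x) I"
    and t: "((\<lambda>i. cinner (v i) (u i)) has_sum t) I"
  shows "has_trace A t"
  unfolding has_trace_def
proof (intro allI impI)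
  fix B :: "'a set" assume B: "is_onb B"
  note on = is_onb_orthonormal[OF B]
  define F where "F = (\<lambda>(i, e). cinner (v i) e * cinner e (u i))"
  have "(\<lambda>i. \<Sum>\<^sub>\<infinity>e\<in>B. cmod (F (i, e))) summable_on I"
    using uv
  proof (rule summable_on_comparison_test)
    show "(\<Sum>\<^sub>\<infinity>e\<in>B. cmod (F (i, e))) \<le> norm (u i) * norm (v i)" for i
      using infsum_cmod_cinner_le[OF on, of "v i" "u i"] by (simp add: F_def mult.commute)
  qed (simp add: infsum_nonneg)
  then have "(\<lambda>p. cmod (F p)) summable_on (I \<times> B)"
  proof (rule summable_on_SigmaI[rotated])
    show "((\<lambda>e. cmod (F (i, e))) has_sum (\<Sum>\<^sub>\<infinity>e\<in>B. cmod (F (i, e)))) B" for i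
      using abs_summable_cinner[OF on, of "v i" "u i"] by (intro has_sum_infsum) (simp add: F_def)
  qed simp
  then have F: "F summable_on (I \<times> B)"
    by (rule abs_summable_summable)
  have "(F has_sum t) (I \<times> B)"
    by (rule has_sum_SigmaI[OF _ t F]) (use parseval[OF B] in \<open>simp add: F_def\<close>)
  then have "((\<lambda>(e, i). F (i, e)) has_sum t) (B \<times> I)"
    by (simp only: has_sum_swap[of F])
  then show "((\<lambda>e. cinner e (A e)) has_sum t) B"
  proof (rule has_sum_SigmaD)
    fix e
    show "((\<lambda>i. case (e, i) of (e, i) \<Rightarrow> F (i, e)) has_sum cinner e (A e)) I"
      using has_sum_bounded_linear[OF bounded_linear_cinner_right A[of e], of e]
      by (simp add: F_def cinner_scaleC_right)
  qed
qed

lemma has_trace_diag: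
  fixes S :: "'a::chilbert_space set"
  assumes S: "is_onb S" and a: "(a has_sum t) S"
  shows "has_trace (diag S a) (complex_of_real t)"
proof -
  note on = is_onb_orthonormal[OF S]
  have abs: "(\<lambda>s. \<bar>a s\<bar>) summable_on S"
    using a summable_on_iff_abs_summable_on_real[of a S] by (auto simp: summable_on_def)
  have K: "\<forall>s\<in>S. \<bar>a s\<bar> \<le> (\<Sum>\<^sub>\<infinity>s\<in>S. \<bar>a s\<bar>)"
    using finite_sum_le_infsum[OF abs, of "{_}"] by auto
  show ?thesis
  proof (rule has_trace_rank_one_series)
    show "(\<lambda>s. norm (complex_of_real (a s) *\<^sub>C s) * norm s) summable_on S"
      using abs by (rule summable_on_cong[THEN iffD1, rotated])
        (simp add: norm_scaleC orthonormal_norm[OF on])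
    show "((\<lambda>s. cinner s x *\<^sub>C complex_of_real (a s) *\<^sub>C s) has_sum diag S a x) S" for x
      using diag_has_sum[OF on K, of x] by (simp add: scaleC_scaleC mult.commute)
    have "((\<lambda>s. complex_of_real (a s)) has_sum complex_of_real t) S"
      using a by (simp only: has_sum_of_real_iff)
    then show "((\<lambda>s. cinner s (complex_of_real (a s) *\<^sub>C s)) has_sum complex_of_real t) S"
      by (rule has_sum_cong[THEN iffD1, rotated]) (simp add: cinner_scaleC_right orthonormalD[OF on])
  qed
qed

text \<open>The trace is tested in the eigenbasis itself. This is how finite entropy, given as
  \<open>trace_class\<close>, becomes convergence of the sum of \<open>t * ln t\<close> over the
  eigenvalues.\<close>

lemma has_trace_diag_imp_has_sum:
  assumes S: "is_onb S" and K: "\<forall>s\<in>S. \<bar>a s\<bar> \<le> K" and tr: "has_trace (diag S a) t"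
  shows "(a has_sum Re t) S"
proof -
  note on = is_onb_orthonormal[OF S]
  have "((\<lambda>s. Re (cinner s (diag S a s))) has_sum Re t) S"
    using tr S by (intro has_sum_Re) (simp add: has_trace_def)
  then show ?thesis
    by (rule has_sum_cong[THEN iffD1, rotated]) (simp add: cinner_diag[OF on K] orthonormalD[OF on])
qed

section \<open>Doubly stochastic weights between two orthonormal bases\<close>

definition overlap :: "'a::chilbert_space \<times> 'a \<Rightarrow> real" where
  "overlap = (\<lambda>(s, t). (cmod (cinner s t))\<^sup>2)"

lemma overlap_nonneg [simp]: "0 \<le> overlap p"
  by (auto simp: overlap_def split: prod.split)

lemma overlap_le_one:
  assumes "is_onb S" "is_onb T" "p \<in> S \<times> T"
  shows "overlap p \<le> 1"
proof -
  obtain s t where p: "p = (s, t)" "s \<in> S" "t \<in> T" using assms(3) by auto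
  then have "norm s = 1" "norm t = 1"
    using assms(1,2) by (auto intro: orthonormal_norm is_onb_orthonormal)
  then have "cmod (cinner s t) \<le> 1" using cmod_cinner_le[of s t] by simp
  then show ?thesis by (simp add: overlap_def p power_le_one)
qed

lemma overlap_has_sum_right:
  assumes "is_onb S" "is_onb T" "s \<in> S"
  shows "((\<lambda>t. overlap (s, t)) has_sum 1) T"
  using parseval_norm[OF assms(2), of s] orthonormal_norm[OF is_onb_orthonormal[OF assms(1)] assms(3)]
  by (simp add: overlap_def cmod_cinner_commute[of s])

lemma overlap_swap: "overlap (s, t) = overlap (t, s)"
  by (simp add: overlap_def cmod_cinner_commute[of s])

lemma overlap_weighted_summable:
  fixes a b :: "'a::chilbert_space \<Rightarrow> real"
  assumes S: "is_onb S" and T: "is_onb T" and a: "a summable_on S" and K: "\<forall>t\<in>T. \<bar>b t\<bar> \<le> K"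
  shows "(\<lambda>(s, t). a s * b t * overlap (s, t)) summable_on (S \<times> T)"
proof -
  have "(\<lambda>s. \<bar>a s\<bar>) summable_on S"
    using a summable_on_iff_abs_summable_on_real[of a S] by auto
  \<comment> \<open>The factor \<open>1\<close> stands for the row sum of \<open>overlap\<close>.
    \<open>\<bar>K\<bar>\<close> replaces \<open>K\<close> because an empty \<open>T\<close> would
    leave the sign of \<open>K\<close> open.\<close>
  then have "(\<lambda>s. \<bar>a s\<bar> * \<bar>K\<bar> * 1) summable_on S"
    by (intro summable_on_cmult_left)
  then have "(\<lambda>(s, t). \<bar>a s\<bar> * \<bar>K\<bar> * overlap (s, t)) summable_on (S \<times> T)"
  proof (rule summable_on_SigmaI[rotated])
    show "((\<lambda>t. case (s, t) of (s, t) \<Rightarrow> \<bar>a s\<bar> * \<bar>K\<bar> * overlap (s, t))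
        has_sum \<bar>a s\<bar> * \<bar>K\<bar> * 1) T" if "s \<in> S" for s
      unfolding prod.case by (rule has_sum_cmult_right[OF overlap_has_sum_right[OF S T that]])
  qed simp
  then have "(\<lambda>p. norm (case p of (s, t) \<Rightarrow> a s * b t * overlap (s, t))) summable_on (S \<times> T)"
  proof (rule Infinite_Sum.abs_summable_on_comparison_test')
    fix p assume "p \<in> S \<times> T"
    moreover from this obtain s t where "p = (s, t)" "t \<in> T" by auto
    moreover have "\<bar>b t\<bar> \<le> \<bar>K\<bar>" using K \<open>t \<in> T\<close> by force
    ultimately show "norm (case p of (s, t) \<Rightarrow> a s * b t * overlap (s, t))
        \<le> (case p of (s, t) \<Rightarrow> \<bar>a s\<bar> * \<bar>K\<bar> * overlap (s, t))"
      by (auto simp: abs_mult intro!: mult_right_mono mult_left_mono)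
  qed
  then show ?thesis by (rule abs_summable_summable)
qed

lemma overlap_has_sum_left_marginal:
  assumes S: "is_onb S" and T: "is_onb T" and a: "(a has_sum \<alpha>) S"
  shows "((\<lambda>(s, t). a s * overlap (s, t)) has_sum \<alpha>) (S \<times> T)"
proof (rule has_sum_SigmaI[OF _ a])
  show "((\<lambda>t. case (s, t) of (s, t) \<Rightarrow> a s * overlap (s, t)) has_sum a s) T" if "s \<in> S" for s
    using has_sum_cmult_right[OF overlap_has_sum_right[OF S T that], of "a s"] by simp
  show "(\<lambda>(s, t). a s * overlap (s, t)) summable_on S \<times> T"
    using overlap_weighted_summable[OF S T, of a "\<lambda>_. 1" 1] a by (auto simp: summable_on_def)
qed

lemma overlap_has_sum_right_marginal:
  assumes S: "is_onb S" and T: "is_onb T" and b: "(b has_sum \<beta>) T"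
  shows "((\<lambda>(s, t). b t * overlap (s, t)) has_sum \<beta>) (S \<times> T)"
  using overlap_has_sum_left_marginal[OF T S b]
  by (subst has_sum_swap) (simp add: overlap_swap case_prod_unfold)

text \<open>Trace class times bounded. Moving the self-adjoint factor across the inner product gives
  a rank-one series with vectors \<open>a s\<close> times \<open>s\<close> and
  \<open>diag T b s\<close>, of norm product at most \<open>\<bar>a s\<bar> * \<bar>K\<bar>\<close>;
  expanding \<open>cinner s (diag T b s)\<close> over \<open>T\<close> produces the weights.\<close>

lemma has_trace_diag_diag:
  fixes S T :: "'a::chilbert_space set"
  assumes S: "is_onb S" and T: "is_onb T" and a: "a summable_on S" and K: "\<forall>t\<in>T. \<bar>b t\<bar> \<le> K"
    and c: "((\<lambda>(s, t). a s * b t * overlap (s, t)) has_sum c) (S \<times> T)"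
  shows "has_trace (\<lambda>x. diag S a (diag T b x)) (complex_of_real c)"
proof -
  note onS = is_onb_orthonormal[OF S] and onT = is_onb_orthonormal[OF T]
  have abs: "(\<lambda>s. \<bar>a s\<bar>) summable_on S"
    using a summable_on_iff_abs_summable_on_real[of a S] by auto
  have L: "\<forall>s\<in>S. \<bar>a s\<bar> \<le> (\<Sum>\<^sub>\<infinity>s\<in>S. \<bar>a s\<bar>)"
    using finite_sum_le_infsum[OF abs, of "{_}"] by auto
  have K': "\<forall>t\<in>T. \<bar>b t\<bar> \<le> \<bar>K\<bar>" using K by force
  show ?thesis
  proof (rule has_trace_rank_one_series)
    have "(\<lambda>s. \<bar>a s\<bar> * \<bar>K\<bar>) summable_on S"
      by (rule summable_on_cmult_left[OF abs])
    then show "(\<lambda>s. norm (complex_of_real (a s) *\<^sub>C s) * norm (diag T b s)) summable_on S"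
    proof (rule summable_on_comparison_test)
      fix s assume s: "s \<in> S"
      have "norm (diag T b s) \<le> \<bar>K\<bar>"
        using norm_diag_le[OF T K', of s] orthonormal_norm[OF onS s] by simp
      then show "norm (complex_of_real (a s) *\<^sub>C s) * norm (diag T b s) \<le> \<bar>a s\<bar> * \<bar>K\<bar>"
        using orthonormal_norm[OF onS s] by (simp add: norm_scaleC mult_left_mono)
    qed simp
    show "((\<lambda>s. cinner (diag T b s) x *\<^sub>C complex_of_real (a s) *\<^sub>C s) has_sum diag S a (diag T b x)) S" for x
      using diag_has_sum[OF onS L, of "diag T b x"]
      by (simp add: scaleC_scaleC mult.commute diag_selfadjoint[OF onT K])
    have "((\<lambda>(s, t). complex_of_real (a s * b t * overlap (s, t))) has_sum complex_of_real c) (S \<times> T)"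
      using c by (simp only: case_prod_unfold has_sum_of_real_iff)
    then show "((\<lambda>s. cinner (diag T b s) (complex_of_real (a s) *\<^sub>C s)) has_sum complex_of_real c) S"
    proof (rule has_sum_SigmaD)
      fix s
      have "((\<lambda>t. complex_of_real (a s) * (complex_of_real (b t) * (cinner s t * cinner t s)))
          has_sum complex_of_real (a s) * cinner s (diag T b s)) T"
        by (intro has_sum_cmult_right diag_has_sum_cinner[OF onT K])
      then show "((\<lambda>t. case (s, t) of (s, t) \<Rightarrow> complex_of_real (a s * b t * overlap (s, t)))
          has_sum cinner (diag T b s) (complex_of_real (a s) *\<^sub>C s)) T"
        by (simp add: cinner_scaleC_right diag_selfadjoint[OF onT K] cinner_mult_commute overlap_def
            cmod_cinner_commute[of s] mult.assoc)
    qed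
  qed
qed

section \<open>Scalar inequalities\<close>

text \<open>With t = - ln x the claim reads |1 - t| <= exp (t/2), and for t >= 0 the quadratic
  Taylor polynomial of exp at t/2 already dominates both t - 1 and 1 - t.\<close>

lemma ln_plus_one_sq_le:
  fixes x :: real
  assumes "0 < x" "x \<le> 1"
  shows "(ln x + 1)\<^sup>2 \<le> 1 / x"
proof -
  define t where "t = - ln x"
  have t: "t \<ge> 0" using assms by (simp add: t_def)
  have "0 \<le> (t - 2)\<^sup>2" by simp
  then have "\<bar>1 - t\<bar> \<le> 1 + t/2 + (t/2)\<^sup>2 / 2"
    using t by (simp add: power2_eq_square algebra_simps abs_le_iff)
  also have "\<dots> \<le> exp (t/2)"
    using t by (intro exp_lower_Taylor_quadratic) simp
  finally have "\<bar>1 - t\<bar>\<^sup>2 \<le> (exp (t/2))\<^sup>2"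
    by (rule power_mono) simp
  also have "(exp (t/2))\<^sup>2 = exp t"
    by (simp add: exp_double[symmetric])
  also have "exp t = 1 / x"
    using assms by (simp add: t_def exp_minus divide_simps)
  finally show ?thesis by (simp add: t_def add.commute)
qed

lemma has_real_derivative_xlnx:
  "x > 0 \<Longrightarrow> ((\<lambda>x. x * ln x) has_real_derivative ln x + 1) (at (x::real))"
  by (auto intro!: derivative_eq_intros)

text \<open>This is the concavity of \<open>exp (- x log x)\<close>, whose derivative is minus the function below.\<close>

lemma ln_plus_one_exp_mono:
  fixes a b :: real
  assumes "0 < a" "a \<le> b" "b \<le> 1"
  shows "(ln a + 1) * exp (- (a * ln a)) \<le> (ln b + 1) * exp (- (b * ln b))"
proof (rule DERIV_nonneg_imp_nondecreasing[OF assms(2)])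
  fix x assume x: "a \<le> x" "x \<le> b"
  then have x01: "0 < x" "x \<le> 1" using assms by auto
  have "((\<lambda>x. ln x + 1) has_real_derivative 1 / x) (at x)"
    using x01 by (auto intro!: derivative_eq_intros)
  moreover have "((\<lambda>x. exp (- (x * ln x))) has_real_derivative exp (- (x * ln x)) * - (ln x + 1)) (at x)"
    by (intro DERIV_fun_exp DERIV_minus has_real_derivative_xlnx x01)
  ultimately have "((\<lambda>x. (ln x + 1) * exp (- (x * ln x))) has_real_derivative
      1 / x * exp (- (x * ln x)) + exp (- (x * ln x)) * - (ln x + 1) * (ln x + 1)) (at x)"
    by (rule DERIV_mult)
  moreover have "1 / x * exp (- (x * ln x)) + exp (- (x * ln x)) * - (ln x + 1) * (ln x + 1)
      = exp (- (x * ln x)) * (1 / x - (ln x + 1)\<^sup>2)"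
    by (simp add: algebra_simps power2_eq_square)
  ultimately have "((\<lambda>x. (ln x + 1) * exp (- (x * ln x))) has_real_derivative
      exp (- (x * ln x)) * (1 / x - (ln x + 1)\<^sup>2)) (at x)"
    by (simp only:)
  moreover have "exp (- (x * ln x)) * (1 / x - (ln x + 1)\<^sup>2) \<ge> 0"
    using ln_plus_one_sq_le[OF x01] by simp
  ultimately show "\<exists>y. ((\<lambda>x. (ln x + 1) * exp (- (x * ln x))) has_real_derivative y) (at x) \<and> 0 \<le> y"
    by blast
qed

text \<open>\<open>\<phi>\<close> is the right side minus the left as a function of
  \<open>r\<close>. It vanishes at \<open>s\<close>, and since \<open>k\<close> is monotone its
  derivative changes sign there from minus to plus, so \<open>s\<close> is a minimum.\<close>

lemma exp_xlnx_diff_le_pos: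
  fixes r s :: real
  assumes r: "0 < r" "r \<le> 1" and s: "0 < s" "s \<le> 1"
  shows "exp (s * ln s - r * ln r) - 1 \<le> (s - r) * (ln s + 1)"
proof -
  define k where "k x = (ln x + 1) * exp (- (x * ln x))" for x :: real
  define \<phi> where "\<phi> x = 1 + (s - x) * (ln s + 1) - exp (s * ln s - x * ln x)" for x
  have deriv: "(\<phi> has_real_derivative exp (s * ln s) * (k x - k s)) (at x)" if "x > 0" for x
  proof -
    have "(\<phi> has_real_derivative 0 + (0 - 1) * (ln s + 1) - exp (s * ln s - x * ln x) * (0 - (ln x + 1))) (at x)"
      unfolding \<phi>_def
      by (intro DERIV_diff DERIV_add DERIV_const DERIV_cmult_right DERIV_ident DERIV_fun_exp
          has_real_derivative_xlnx that)
    moreover have "exp (s * ln s) * k x = exp (s * ln s - x * ln x) * (ln x + 1)" for x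
      by (simp add: k_def diff_conv_add_uminus exp_add del: add_uminus_conv_diff)
    ultimately show ?thesis by (simp add: algebra_simps)
  qed
  have "\<phi> s \<le> \<phi> r"
  proof (cases "r \<le> s")
    case True
    show ?thesis
    proof (rule DERIV_nonpos_imp_nonincreasing[OF True])
      fix x assume x: "r \<le> x" "x \<le> s"
      then have "k x \<le> k s"
        unfolding k_def using r s by (intro ln_plus_one_exp_mono) auto
      then have "exp (s * ln s) * (k x - k s) \<le> 0"
        by (simp add: mult_le_0_iff)
      then show "\<exists>y. (\<phi> has_real_derivative y) (at x) \<and> y \<le> 0"
        using deriv[of x] x r by force
    qed
  next
    case False
    then have "s \<le> r" by simp
    then show ?thesis
    proof (rule DERIV_nonneg_imp_nondecreasing)
      fix x assume x: "s \<le> x" "x \<le> r"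
      then have "k s \<le> k x"
        unfolding k_def using r s by (intro ln_plus_one_exp_mono) auto
      then have "0 \<le> exp (s * ln s) * (k x - k s)" by simp
      then show "\<exists>y. (\<phi> has_real_derivative y) (at x) \<and> 0 \<le> y"
        using deriv[of x] x s by force
    qed
  qed
  then show ?thesis by (simp add: \<phi>_def)
qed

text \<open>The case \<open>r = 0\<close> is the limit of positive \<open>r\<close>, as x log x
  tends to 0, in agreement with the value of \<open>0 * ln 0\<close>.\<close>

lemma exp_xlnx_diff_le:
  fixes r s :: real
  assumes r: "0 \<le> r" "r \<le> 1" and s: "0 < s" "s \<le> 1"
  shows "exp (s * ln s - r * ln r) - 1 \<le> (s - r) * (ln s + 1)"
proof (cases "r = 0")
  case True
  have f: "((\<lambda>x::real. x * ln x) \<longlongrightarrow> 0) (at_right 0)" by real_asymp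
  have "((\<lambda>x. exp (s * ln s - x * ln x) - 1) \<longlongrightarrow> exp (s * ln s - 0) - 1) (at_right 0)"
    by (intro tendsto_intros f)
  moreover have "((\<lambda>x. (s - x) * (ln s + 1)) \<longlongrightarrow> (s - 0) * (ln s + 1)) (at_right 0)"
    by (intro tendsto_intros)
  moreover have "eventually (\<lambda>x. exp (s * ln s - x * ln x) - 1 \<le> (s - x) * (ln s + 1)) (at_right 0)"
    unfolding eventually_at_right_field
    by (rule exI[of _ 1]) (use exp_xlnx_diff_le_pos s in auto)
  ultimately have "exp (s * ln s - 0) - 1 \<le> (s - 0) * (ln s + 1)"
    by (intro tendsto_le[of "at_right (0::real)"]) auto
  then show ?thesis using True by simp
next
  case False
  then show ?thesis using exp_xlnx_diff_le_pos[of r s] r s by simp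
qed

text \<open>The crude -1 in place of the optimal -1/e suffices: it puts the exponents into the range
  where |exp u - 1| <= 2 |u| is available.\<close>

lemma xlnx_bounds:
  fixes x :: real
  assumes "0 \<le> x" "x \<le> 1"
  shows "-1 \<le> x * ln x" "x * ln x \<le> 0"
proof -
  show "-1 \<le> x * ln x"
  proof (cases "x = 0")
    case False
    have "ln (1/x) \<le> 1/x - 1"
      using False assms by (intro ln_le_minus_one) auto
    then have "x * ln (1/x) \<le> x * (1/x - 1)"
      using assms by (intro mult_left_mono) auto
    then show ?thesis using False assms by (simp add: ln_div algebra_simps)
  qed simp
  show "x * ln x \<le> 0"
    using assms by (cases "x = 0") (auto simp: mult_le_0_iff)
qed

lemma exp_minus_one_abs_le:
  fixes x :: real
  assumes "\<bar>x\<bar> \<le> 1"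
  shows "\<bar>exp x - 1\<bar> \<le> 2 * \<bar>x\<bar>"
proof (cases "x \<ge> 0")
  case True
  have "exp x \<le> 1 + x + x\<^sup>2"
    using True assms by (intro exp_bound) auto
  moreover have "x * x \<le> x * 1"
    using True assms by (intro mult_left_mono) auto
  ultimately show ?thesis using True by (simp add: power2_eq_square)
next
  case False
  then have "\<bar>exp x - 1\<bar> = 1 - exp x" by simp
  then show ?thesis using False exp_ge_add_one_self[of x] by linarith
qed

text \<open>By the tangent inequality this is at most \<open>- r log s\<close>, which is \<open>\<infinity>\<close> in the paper for \<open>s = 0 < r\<close>
  but \<open>0\<close> in HOL; hence the comparison only with the limit of \<open>- r log (s + \<epsilon>)\<close> below.\<close>

definition entropy_gap :: "real \<Rightarrow> real \<Rightarrow> real" where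
  "entropy_gap r s = exp (s * ln s - r * ln r) - 1 - s * ln s + r - s"

text \<open>For \<open>s > 0\<close> the right side tends to at least the gap, by the tangent
  inequality, and \<open>\<delta>\<close> leaves room. For \<open>s = 0 < r\<close> it diverges to
  infinity before weighting. For \<open>r = s = 0\<close> the gap is 0. The bound
  \<open>w \<le> 1\<close> keeps the error below \<open>\<delta>\<close> after weighting.\<close>

lemma eventually_entropy_gap_le:
  fixes r s w \<delta> :: real
  assumes r: "0 \<le> r" "r \<le> 1" and s: "0 \<le> s" "s \<le> 1" and w: "0 \<le> w" "w \<le> 1" and \<delta>: "\<delta> > 0"
  shows "eventually (\<lambda>\<epsilon>. entropy_gap r s * w - \<delta> \<le> - (r * ln (s + \<epsilon>)) * w) (at_right 0)"
proof -
  have "eventually (\<lambda>\<epsilon>. entropy_gap r s - \<delta> \<le> - (r * ln (s + \<epsilon>))) (at_right 0)"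
  proof (cases "s = 0")
    case False
    have "((\<lambda>\<epsilon>. - (r * ln (s + \<epsilon>))) \<longlongrightarrow> - (r * ln (s + 0))) (at_right 0)"
      using False s by (intro tendsto_intros) auto
    moreover have "entropy_gap r s - \<delta> < - (r * ln (s + 0))"
      using exp_xlnx_diff_le[of r s] False r s \<delta> by (simp add: entropy_gap_def algebra_simps)
    ultimately have "eventually (\<lambda>\<epsilon>. entropy_gap r s - \<delta> < - (r * ln (s + \<epsilon>))) (at_right 0)"
      by (rule order_tendstoD)
    then show ?thesis by (rule eventually_mono) simp
  next
    case s0: True
    show ?thesis
    proof (cases "r = 0")
      case True
      then show ?thesis using s0 \<delta> by (simp add: entropy_gap_def)
    next
      case False
      have "filterlim (\<lambda>\<epsilon>. - (r * ln \<epsilon>)) at_top (at_right 0)"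
        using False r by real_asymp
      then show ?thesis
        using s0 by (simp add: filterlim_at_top)
    qed
  qed
  then show ?thesis
  proof (rule eventually_mono)
    fix \<epsilon> assume "entropy_gap r s - \<delta> \<le> - (r * ln (s + \<epsilon>))"
    then have "(entropy_gap r s - \<delta>) * w \<le> - (r * ln (s + \<epsilon>)) * w"
      using w by (intro mult_right_mono)
    moreover have "\<delta> * w \<le> \<delta> * 1"
      using w \<delta> by (intro mult_left_mono) auto
    ultimately show "entropy_gap r s * w - \<delta> \<le> - (r * ln (s + \<epsilon>)) * w"
      by (simp add: algebra_simps)
  qed
qed

text \<open>The terms \<open>- r ln (s + \<epsilon>)\<close> become nonnegative after adding \<open>r ln (1 + \<epsilon>)\<close>, so all but
  finitely many of them may be dropped before letting \<open>\<epsilon>\<close> tend to \<open>0\<close>.\<close>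

lemma entropy_gap_sum_le:
  fixes r s w :: "'i \<Rightarrow> real"
  assumes r: "\<And>i. i \<in> I \<Longrightarrow> 0 \<le> r i \<and> r i \<le> 1" and s: "\<And>i. i \<in> I \<Longrightarrow> 0 \<le> s i \<and> s i \<le> 1"
    and w: "\<And>i. i \<in> I \<Longrightarrow> 0 \<le> w i \<and> w i \<le> 1"
    and rw: "((\<lambda>i. r i * w i) has_sum 1) I"
    and L: "((\<lambda>i. entropy_gap (r i) (s i) * w i) has_sum L) I"
    and E: "\<And>\<epsilon>. \<epsilon> > 0 \<Longrightarrow> ((\<lambda>i. r i * ln (s i + \<epsilon>) * w i) has_sum E \<epsilon>) I"
    and \<delta>: "\<delta> > 0"
  shows "\<exists>\<epsilon>>0. L - \<delta> \<le> - E \<epsilon>"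
proof -
  obtain F where F: "finite F" "F \<subseteq> I"
    and LF: "dist (\<Sum>i\<in>F. entropy_gap (r i) (s i) * w i) L \<le> \<delta> / 3"
    using has_sum_finite_approximation[OF L, of "\<delta> / 3"] \<delta> by auto
  \<comment> \<open>\<open>\<delta>\<close> is spent in thirds: on replacing \<open>L\<close> by a
    finite sum, on an error \<open>\<eta>\<close> at each index in \<open>F\<close>, and on
    \<open>ln (1 + \<epsilon>)\<close>. The \<open>+ 1\<close> covers an empty
    \<open>F\<close>.\<close>
  define \<eta> where "\<eta> = \<delta> / (3 * (card F + 1))"
  have \<eta>: "\<eta> > 0" using \<delta> by (simp add: \<eta>_def)
  have card: "card F * \<eta> \<le> \<delta> / 3"
    using \<delta> by (simp add: \<eta>_def field_simps)
  have "((\<lambda>\<epsilon>::real. ln (1 + \<epsilon>)) \<longlongrightarrow> ln (1 + 0)) (at_right 0)"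
    by (intro tendsto_intros) auto
  then have "eventually (\<lambda>\<epsilon>. ln (1 + \<epsilon>) < \<delta> / 3) (at_right 0)"
    by (rule order_tendstoD) (use \<delta> in simp)
  moreover have "eventually (\<lambda>\<epsilon>. \<forall>i\<in>F. entropy_gap (r i) (s i) * w i - \<eta>
      \<le> - (r i * ln (s i + \<epsilon>)) * w i) (at_right 0)"
  proof (rule eventually_ball_finite[OF F(1)], rule ballI)
    fix i assume "i \<in> F"
    then have "i \<in> I" using F by blast
    then show "eventually (\<lambda>\<epsilon>. entropy_gap (r i) (s i) * w i - \<eta> \<le> - (r i * ln (s i + \<epsilon>)) * w i) (at_right 0)"
      using r s w \<eta> by (intro eventually_entropy_gap_le) auto
  qed
  ultimately have "eventually (\<lambda>\<epsilon>. ln (1 + \<epsilon>) < \<delta> / 3 \<and> (\<forall>i\<in>F. entropy_gap (r i) (s i) * w i - \<eta>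
      \<le> - (r i * ln (s i + \<epsilon>)) * w i) \<and> \<epsilon> > 0) (at_right (0::real))"
    by (intro eventually_conj eventually_at_right_less)
  from eventually_happens'[OF _ this] obtain \<epsilon> :: real where \<epsilon>: "\<epsilon> > 0"
    and ln\<epsilon>: "ln (1 + \<epsilon>) < \<delta> / 3"
    and gap: "\<And>i. i \<in> F \<Longrightarrow> entropy_gap (r i) (s i) * w i - \<eta> \<le> - (r i * ln (s i + \<epsilon>)) * w i"
    by (auto simp: trivial_limit_at_right_real)
  define q where "q i = ln (1 + \<epsilon>) * (r i * w i) - r i * ln (s i + \<epsilon>) * w i" for i
  \<comment> \<open>Making the terms nonnegative costs only \<open>ln (1 + \<epsilon>)\<close> in
    total, however many there are, because the \<open>r i * w i\<close> sum to 1.\<close>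
  have q: "(q has_sum (ln (1 + \<epsilon>) * 1 - E \<epsilon>)) I"
    using has_sum_add[OF has_sum_cmult_right[OF rw, of "ln (1 + \<epsilon>)"] has_sum_uminusI[OF E[OF \<epsilon>]]]
    by (simp add: q_def[abs_def])
  have "q i \<ge> 0" if "i \<in> I" for i
  proof -
    have "ln (s i + \<epsilon>) \<le> ln (1 + \<epsilon>)"
      using s[OF that] \<epsilon> by simp
    then have "ln (s i + \<epsilon>) * (r i * w i) \<le> ln (1 + \<epsilon>) * (r i * w i)"
      using r[OF that] w[OF that] by (intro mult_right_mono) auto
    then show ?thesis by (simp add: q_def mult_ac)
  qed
  then have "sum q F \<le> ln (1 + \<epsilon>) * 1 - E \<epsilon>"
    by (intro finite_sum_le_has_sum[OF q]) (use F in auto)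
  moreover have "(\<Sum>i\<in>F. entropy_gap (r i) (s i) * w i - \<eta>) \<le> sum q F"
  proof (rule sum_mono)
    fix i assume i: "i \<in> F"
    then have "0 \<le> ln (1 + \<epsilon>) * (r i * w i)"
      using r[of i] w[of i] F \<epsilon> by auto
    then show "entropy_gap (r i) (s i) * w i - \<eta> \<le> q i"
      using gap[OF i] by (simp add: q_def)
  qed
  ultimately have "L - \<delta> \<le> - E \<epsilon>"
    using LF card ln\<epsilon> unfolding sum_subtractf sum_constant dist_real_def by linarith
  with \<epsilon> show ?thesis by blast
qed

section \<open>Entropies of density operators\<close>

lemma density_operator_positive_operator: "density_operator \<rho> \<Longrightarrow> positive_operator \<rho>"
  unfolding density_operator_def bounded_clinear_def positive_operator_def by blast

lemma density_operator_eigenbasis: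
  fixes \<rho> :: "'a::chilbert_space \<Rightarrow> 'a"
  assumes \<rho>: "density_operator \<rho>"
  obtains S lam where "is_onb S" "\<And>s. s \<in> S \<Longrightarrow> \<rho> s = lam s *\<^sub>R s"
    "\<And>s. s \<in> S \<Longrightarrow> 0 \<le> lam s \<and> lam s \<le> 1" "(lam has_sum 1) S"
proof -
  interpret positive_operator \<rho> by (rule density_operator_positive_operator[OF \<rho>])
  have tr: "has_trace \<rho> 1" using \<rho> by (simp add: density_operator_def)
  obtain S where S: "is_onb S" and "\<And>s. s \<in> S \<Longrightarrow> \<exists>l. \<rho> s = l *\<^sub>R s"
    using eigenbasis_exists[OF tr] by blast
  then obtain lam where lam: "\<And>s. s \<in> S \<Longrightarrow> \<rho> s = lam s *\<^sub>R s" by metis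
  have diag: "cinner s (\<rho> s) = complex_of_real (lam s)" if "s \<in> S" for s
    using that by (simp add: lam cinner_scaleR_right orthonormalD[OF is_onb_orthonormal[OF S]])
  have lam0: "0 \<le> lam s" if "s \<in> S" for s
    using nonneg[of s] by (simp add: diag[OF that])
  have "((\<lambda>s. Re (cinner s (\<rho> s))) has_sum Re 1) S"
    using tr S by (intro has_sum_Re) (simp add: has_trace_def)
  then have "(lam has_sum Re 1) S"
    by (rule has_sum_cong[THEN iffD1, rotated]) (simp add: diag)
  then have sum: "(lam has_sum 1) S" by simp
  have "lam s \<le> 1" if "s \<in> S" for s
    using finite_sum_le_has_sum[OF sum, of "{s}"] lam0 that by auto
  with S lam lam0 sum that show ?thesis by blast
qed

text \<open>For each \<epsilon> > 0 the operator log (\<sigma> + \<epsilon>) is bounded, so the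
  diagonal calculus applies to it even if \<sigma> has a kernel.\<close>

lemma abs_ln_add_le:
  fixes x e :: real
  assumes "0 \<le> x" "x \<le> 1" "e > 0"
  shows "\<bar>ln (x + e)\<bar> \<le> \<bar>ln e\<bar> + \<bar>ln (1 + e)\<bar>"
proof -
  have "ln e \<le> ln (x + e)" "ln (x + e) \<le> ln (1 + e)"
    using assms by auto
  then show ?thesis by linarith
qed

lemma summable_on_exp_minus_one:
  fixes y :: "'i \<Rightarrow> real"
  assumes y: "y summable_on I" and bound: "\<And>i. i \<in> I \<Longrightarrow> \<bar>y i\<bar> \<le> 1"
  shows "(\<lambda>i. exp (y i) - 1) summable_on I"
proof -
  have "(\<lambda>i. 2 * \<bar>y i\<bar>) summable_on I"
    using y summable_on_iff_abs_summable_on_real[of y I] by (intro summable_on_cmult_right) simp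
  then have "(\<lambda>i. norm (exp (y i) - 1)) summable_on I"
    by (rule Infinite_Sum.abs_summable_on_comparison_test') (simp add: exp_minus_one_abs_le bound)
  then show ?thesis by (rule abs_summable_summable)
qed

text \<open>The two trace-class assumptions say that both entropies are finite. They give meaning to
  the difference of entropies and provide the summability from which the trace of the exponential
  term is obtained.\<close>

theorem theorem5p1:
  fixes \<rho> \<sigma> :: "'a::chilbert_space \<Rightarrow> 'a"
  assumes "density_operator \<rho>" and "density_operator \<sigma>"
    and "trace_class (fun_calc (\<lambda>t. t * ln t) \<rho>)"
    and "trace_class (fun_calc (\<lambda>t. t * ln t) \<sigma>)"
  shows "rel_entropy \<rho> \<sigma> \<ge>
           ereal (vn_entropy \<sigma> - vn_entropy \<rho> +
             Re (op_trace (\<lambda>x. fun_calc (\<lambda>t. exp (- (t * ln t))) \<rho>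
                                (fun_calc (\<lambda>t. exp (t * ln t)) \<sigma> x) - x))) \<and>
         vn_entropy \<sigma> - vn_entropy \<rho> +
           Re (op_trace (\<lambda>x. fun_calc (\<lambda>t. exp (- (t * ln t))) \<rho>
                              (fun_calc (\<lambda>t. exp (t * ln t)) \<sigma> x) - x)) \<ge> 0"
proof -
  interpret \<rho>: positive_operator \<rho>
    by (rule density_operator_positive_operator[OF assms(1)])
  interpret \<sigma>: positive_operator \<sigma>
    by (rule density_operator_positive_operator[OF assms(2)])
  obtain S r where S: "is_onb S" and \<rho>: "\<And>s. s \<in> S \<Longrightarrow> \<rho> s = r s *\<^sub>R s"
    and r: "\<And>s. s \<in> S \<Longrightarrow> 0 \<le> r s \<and> r s \<le> 1" and r_sum: "(r has_sum 1) S"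
    by (rule density_operator_eigenbasis[OF assms(1)]) blast
  obtain T q where T: "is_onb T" and \<sigma>: "\<And>t. t \<in> T \<Longrightarrow> \<sigma> t = q t *\<^sub>R t"
    and q: "\<And>t. t \<in> T \<Longrightarrow> 0 \<le> q t \<and> q t \<le> 1" and q_sum: "(q has_sum 1) T"
    by (rule density_operator_eigenbasis[OF assms(2)]) blast
  note on = is_onb_orthonormal[OF S] is_onb_orthonormal[OF T]
  define x where "x s = r s * ln (r s)" for s
  define y where "y t = q t * ln (q t)" for t
  have x: "-1 \<le> x s" "x s \<le> 0" if "s \<in> S" for s
    using r[OF that] by (auto simp: x_def intro: xlnx_bounds)
  have y: "-1 \<le> y t" "y t \<le> 0" if "t \<in> T" for t
    using q[OF that] by (auto simp: y_def intro: xlnx_bounds)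
  have x_bd: "\<forall>s\<in>S. \<bar>x s\<bar> \<le> 1" and y_bd: "\<forall>t\<in>T. \<bar>y t\<bar> \<le> 1"
    using x y by force+
  have calc_x: "fun_calc (\<lambda>t. t * ln t) \<rho> = diag S x"
    unfolding x_def by (rule \<rho>.fun_calc_eq_diag[OF S \<rho> x_bd[unfolded x_def]])
  have calc_y: "fun_calc (\<lambda>t. t * ln t) \<sigma> = diag T y"
    unfolding y_def by (rule \<sigma>.fun_calc_eq_diag[OF T \<sigma> y_bd[unfolded y_def]])
  obtain X where X: "(x has_sum X) S"
    using assms(3) has_trace_diag_imp_has_sum[OF S x_bd] unfolding calc_x trace_class_def by blast
  obtain Y where Y: "(y has_sum Y) T"
    using assms(4) has_trace_diag_imp_has_sum[OF T y_bd] unfolding calc_y trace_class_def by blast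
  have S_\<rho>: "vn_entropy \<rho> = - X" and S_\<sigma>: "vn_entropy \<sigma> = - Y"
    unfolding vn_entropy_def calc_x calc_y
    by (simp_all add: has_trace_op_trace[OF has_trace_diag[OF S X]]
        has_trace_op_trace[OF has_trace_diag[OF T Y]])

  define g where "g s = exp (- x s)" for s
  define h where "h t = exp (y t)" for t
  have g_bd: "\<forall>s\<in>S. \<bar>g s\<bar> \<le> exp 1" and h_bd: "\<forall>t\<in>T. \<bar>h t\<bar> \<le> 1"
    using x y by (force simp: g_def h_def)+
  have calc_g: "fun_calc (\<lambda>t. exp (- (t * ln t))) \<rho> = diag S g"
    unfolding g_def x_def
    by (rule \<rho>.fun_calc_eq_diag[OF S \<rho> g_bd[unfolded g_def x_def]])
  have calc_h: "fun_calc (\<lambda>t. exp (t * ln t)) \<sigma> = diag T h"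
    unfolding h_def y_def
    by (rule \<sigma>.fun_calc_eq_diag[OF T \<sigma> h_bd[unfolded h_def y_def]])
  have "(\<lambda>s. - x s) summable_on S"
    using X by (auto simp: summable_on_def intro: has_sum_uminusI)
  from summable_on_exp_minus_one[OF this] have g1: "(\<lambda>s. g s - 1) summable_on S"
    using x_bd by (simp add: g_def)
  have "(\<lambda>t. h t - 1) summable_on T"
    using Y y_bd unfolding h_def by (intro summable_on_exp_minus_one) (auto simp: summable_on_def)
  then obtain H where H: "((\<lambda>t. h t - 1) has_sum H) T" by (auto simp: summable_on_def)
  obtain G where G: "((\<lambda>(s, t). (g s - 1) * h t * overlap (s, t)) has_sum G) (S \<times> T)"
    using overlap_weighted_summable[OF S T g1 h_bd] by (auto simp: summable_on_def)
  \<comment> \<open>The first summand is a summable diagonal times a bounded one, the second a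
    summable diagonal; both have a trace.\<close>
  have split: "diag S g (diag T h z) - z
      = diag S (\<lambda>s. g s - 1) (diag T h z) + diag T (\<lambda>t. h t - 1) z" for z
    using diag_diff[OF on(1) g_bd, of "\<lambda>_. 1" 1 "diag T h z"] diag_diff[OF on(2) h_bd, of "\<lambda>_. 1" 1 z]
    by (simp add: diag_one S T)
  have "has_trace (\<lambda>z. diag S g (diag T h z) - z) (complex_of_real G + complex_of_real H)"
    unfolding split by (intro has_trace_add has_trace_diag_diag[OF S T g1 h_bd G] has_trace_diag[OF T H])
  then have tr_gh: "Re (op_trace (\<lambda>z. diag S g (diag T h z) - z)) = G + H"
    by (simp add: has_trace_op_trace)

  define w where "w = (overlap :: 'a \<times> 'a \<Rightarrow> real)"
  note left = overlap_has_sum_left_marginal[OF S T, unfolded case_prod_unfold prod.collapse w_def[symmetric]]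
    and right = overlap_has_sum_right_marginal[OF S T, unfolded case_prod_unfold prod.collapse w_def[symmetric]]
  have G': "((\<lambda>p. (g (fst p) - 1) * h (snd p) * w p) has_sum G) (S \<times> T)"
    using G by (simp only: case_prod_unfold prod.collapse w_def)
  have "((\<lambda>p. (g (fst p) - 1) * h (snd p) * w p + (h (snd p) - 1) * w p) has_sum G + H) (S \<times> T)"
    by (intro has_sum_add G' right H)
  then have GH: "((\<lambda>p. (exp (y (snd p) - x (fst p)) - 1) * w p) has_sum G + H) (S \<times> T)"
    by (rule has_sum_cong[THEN iffD1, rotated])
      (simp add: g_def h_def exp_diff exp_minus field_simps)

  have "((\<lambda>p. (exp (y (snd p) - x (fst p)) - 1) * w p + (- (y (snd p) * w p) + x (fst p) * w p))
      has_sum (G + H + (- Y + X))) (S \<times> T)"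
    by (intro has_sum_add has_sum_uminusI GH left right X Y)
  then have "0 \<le> G + H + (- Y + X)"
  proof (rule has_sum_nonneg)
    fix p
    have "0 \<le> (exp (y (snd p) - x (fst p)) - 1 - (y (snd p) - x (fst p))) * w p"
      using exp_ge_add_one_self[of "y (snd p) - x (fst p)"] unfolding w_def
      by (intro mult_nonneg_nonneg overlap_nonneg) linarith
    then show "0 \<le> (exp (y (snd p) - x (fst p)) - 1) * w p + (- (y (snd p) * w p) + x (fst p) * w p)"
      by (simp add: algebra_simps)
  qed
  then have second: "0 \<le> - Y - - X + (G + H)" by simp

  have "((\<lambda>p. (exp (y (snd p) - x (fst p)) - 1) * w p
        + (- (y (snd p) * w p) + (r (fst p) * w p + - (q (snd p) * w p))))
      has_sum (G + H + (- Y + (1 + - 1)))) (S \<times> T)"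
    by (intro has_sum_add has_sum_uminusI GH left right r_sum q_sum Y)
  \<comment> \<open>\<open>X\<close> stands on both sides of the first inequality, which leaves
    \<open>G + H - Y\<close> to be compared with \<open>- E \<epsilon>\<close>.\<close>
  then have gap: "((\<lambda>p. entropy_gap (r (fst p)) (q (snd p)) * w p) has_sum (G + H - Y)) (S \<times> T)"
    by (simp add: entropy_gap_def x_def y_def algebra_simps)
  define E where "E \<epsilon> = (\<Sum>\<^sub>\<infinity>p\<in>S \<times> T. r (fst p) * ln (q (snd p) + \<epsilon>) * w p)" for \<epsilon>
  have ln_bd: "\<forall>t\<in>T. \<bar>ln (q t + \<epsilon>)\<bar> \<le> \<bar>ln \<epsilon>\<bar> + \<bar>ln (1 + \<epsilon>)\<bar>" if "\<epsilon> > 0" for \<epsilon>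
    using q that by (intro ballI abs_ln_add_le) auto
  have r_summable: "r summable_on S" using r_sum by (auto simp: summable_on_def)
  have E: "((\<lambda>p. r (fst p) * ln (q (snd p) + \<epsilon>) * w p) has_sum E \<epsilon>) (S \<times> T)" if "\<epsilon> > 0" for \<epsilon>
    using overlap_weighted_summable[OF S T r_summable ln_bd[OF that]] unfolding E_def
    by (intro has_sum_infsum) (simp only: case_prod_unfold prod.collapse w_def)
  have tr_E: "Re (op_trace (\<lambda>z. fun_calc (\<lambda>t. t * ln t) \<rho> z - \<rho> (fun_calc (\<lambda>t. ln (t + \<epsilon>)) \<sigma> z))) = X - E \<epsilon>"
    if \<epsilon>: "\<epsilon> > 0" for \<epsilon>
  proof -
    have calc_ln: "fun_calc (\<lambda>t. ln (t + \<epsilon>)) \<sigma> = diag T (\<lambda>t. ln (q t + \<epsilon>))"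
      by (rule \<sigma>.fun_calc_eq_diag[OF T \<sigma> ln_bd[OF \<epsilon>]])
    have E': "((\<lambda>(s, t). r s * ln (q t + \<epsilon>) * overlap (s, t)) has_sum E \<epsilon>) (S \<times> T)"
      using E[OF \<epsilon>] by (simp only: case_prod_unfold prod.collapse w_def)
    have "has_trace (\<lambda>z. diag S x z - diag S r (diag T (\<lambda>t. ln (q t + \<epsilon>)) z))
        (complex_of_real X - complex_of_real (E \<epsilon>))"
      by (intro has_trace_diff has_trace_diag[OF S X] has_trace_diag_diag[OF S T r_summable ln_bd[OF \<epsilon>] E'])
    then show ?thesis
      by (simp add: calc_x calc_ln \<rho>.eq_diag[OF S \<rho>] has_trace_op_trace)
  qed
  have first: "ereal (- Y - - X + (G + H)) \<le> rel_entropy \<rho> \<sigma>"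
  \<comment> \<open>Any single member bounds a supremum from below, so one good
    \<open>\<epsilon>\<close> for each \<open>\<delta>\<close> suffices: no limit is taken under the
    double sum, and an infinite relative entropy needs no separate case.\<close>
  proof (rule ereal_le_epsilon2)
    fix \<delta> :: real assume "\<delta> > 0"
    have "\<exists>\<epsilon>>0. G + H - Y - \<delta> \<le> - E \<epsilon>"
    proof (rule entropy_gap_sum_le[OF _ _ _ _ gap E \<open>\<delta> > 0\<close>])
      show "((\<lambda>p. r (fst p) * w p) has_sum 1) (S \<times> T)" by (rule left[OF r_sum])
      show "0 \<le> w p \<and> w p \<le> 1" if "p \<in> S \<times> T" for p
        using overlap_le_one[OF S T that] by (simp add: w_def)
    qed (use r q in auto)
    then obtain \<epsilon> where \<epsilon>: "\<epsilon> > 0" "G + H - Y - \<delta> \<le> - E \<epsilon>" by blast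
    have "ereal (X - E \<epsilon>) \<le> rel_entropy \<rho> \<sigma>"
      unfolding rel_entropy_def using \<epsilon>(1) by (intro SUP_upper2[of \<epsilon>]) (simp_all add: tr_E)
    then have "ereal (X - E \<epsilon>) + ereal \<delta> \<le> rel_entropy \<rho> \<sigma> + ereal \<delta>"
      by (rule add_right_mono)
    moreover have "ereal (- Y - - X + (G + H)) \<le> ereal (X - E \<epsilon>) + ereal \<delta>"
      using \<epsilon>(2) by simp
    ultimately show "ereal (- Y - - X + (G + H)) \<le> rel_entropy \<rho> \<sigma> + ereal \<delta>"
      by (rule order_trans[rotated])
  qed
  show ?thesis
    unfolding S_\<rho> S_\<sigma> calc_g calc_h tr_gh using first second by blast
qed

end
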